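(* Let $\kappa$ be an infinite cardinal. Suppose $2^\kappa=\kappa^+$ and either $(\kappa^{++},\kappa^+)\twoheadrightarrow(\kappa^+,\kappa)$ holds, or there is a weakly presaturated ideal $I$ on $\kappa^+$ with the property that $\mathcal P(\kappa^+)^V$ is forced (by $\mathcal P(\kappa^+)/I$) to be a member of the generic ultrapower. Then $\square^*_\kappa$ holds.
   Context: $(\kappa^{++},\kappa^+)\twoheadrightarrow(\kappa^+,\kappa)$ asserts that every structure $\mathfrak A$ in a countable language on $\kappa^{++}$ contains a substructure $\mathfrak B$ (elementary, equivalently) such that $|\mathfrak B|=\kappa^+$ and $|\mathfrak B\cap\kappa^+|=\kappa$. An ideal on a set $Z$ is a proper collection of subsets of $Z$ (i.e. not containing $Z$) closed under taking subsets and pairwise unions. For $Z\subseteq\mathcal P(X)$, an ideal $I$ on $Z$ is normal if for all $x\in X$, $\{z\in Z: x\notin z\}\in I$, and $I$ is closed under diagonal unions $\nabla_{x\in X}A_x=\{z:\exists x\in z\,(z\in A_x)\}$. An ideal on a cardinal $\lambda$ is the case $Z=\lambda\subseteq\mathcal P(\lambda)$ (ordinals being viewed as sets of smaller ordinals). Forcing with the Boolean algebra $\mathcal P(Z)/I$ yields a generic $V$-ultrafilter $G$ on $Z$ and a generic ultrapower embedding $j_G:V\to V^Z/G$ (formed using functions in $V$); the well-founded part of $V^Z/G$ is identified with its transitive collapse. A normal ideal $I$ on a successor cardinal $\lambda$ is weakly presaturated if it is forced by $\mathcal P(\lambda)/I$ that $V^\lambda/G$ is well-founded up to $(\lambda^+)^V+1$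 and $j_G(\lambda)=(\lambda^+)^V$. (Here it is applied with $\lambda=\kappa^+$.) $\square^*_\kappa$ states that there is a sequence $\langle\mathcal C_\alpha:\alpha<\kappa^+\rangle$ such that: (1) each $\mathcal C_\alpha$ is a nonempty set of size $\leq\kappa$ consisting of closed unbounded subsets of $\alpha$, each of order-type $\leq\kappa$; (2) if $\alpha<\kappa^+$, $D\in\mathcal C_\alpha$, and $\beta<\alpha$ is a limit point of $D$, then $D\cap\beta\in\mathcal C_\beta$. *)

theory Defs
  imports Main "HOL-Library.Equipollence"
begin

section \<open>The ground universe\<close>

text \<open>
  The type \<open>'v\<close> plays the role of the set-theoretic universe V, and \<open>elts x\<close> is the collection of
  members of \<open>x\<close>. The axioms are those of second-order ZFC without the power set axiom. Power
  sets are assumed individually where they are needed; this covers V itself as well as the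
  structures H(\<open>\<theta>\<close>) for regular uncountable \<open>\<theta>\<close>, so that no inaccessible cardinal is needed for the
  class to have interesting instances. Separation and replacement quantify over arbitrary sets and
  functions of HOL; hence every function from an \<open>elts z\<close> to \<open>'v\<close> is a function in V, every
  subset of an \<open>elts z\<close> is a set of V, and \<open>elts x \<approx> elts y\<close> is equality of cardinality in V.
\<close>

class set_universe =
  fixes elts :: "'a \<Rightarrow> 'a set"
  assumes extensionality: "elts x = elts y \<Longrightarrow> x = y"
    and foundation: "wf {(x, y). x \<in> elts y}"
    and pairing: "\<exists>z. elts z = {x, y}"
    and union: "\<exists>z. elts z = (\<Union>y\<in>elts x. elts y)"
    and separation: "A \<subseteq> elts x \<Longrightarrow> \<exists>z. elts z = A"
    and replacement: "\<exists>z. elts z = f ` elts x"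
    and infinity: "\<exists>x. infinite (elts x)"

definition has_powerset :: "'v::set_universe \<Rightarrow> bool" where
  "has_powerset x \<longleftrightarrow> (\<exists>y. elts y = {z. elts z \<subseteq> elts x})"

definition powerset :: "'v::set_universe \<Rightarrow> 'v" where
  "powerset x = (THE y. elts y = {z. elts z \<subseteq> elts x})"


section \<open>Ordinals and cardinals\<close>

text \<open>By foundation, von Neumann ordinals are the transitive sets of transitive sets.\<close>

definition is_ordinal :: "'v::set_universe \<Rightarrow> bool" where
  "is_ordinal x \<longleftrightarrow>
     (\<forall>y\<in>elts x. elts y \<subseteq> elts x) \<and> (\<forall>y\<in>elts x. \<forall>z\<in>elts y. elts z \<subseteq> elts y)"

definition is_cardinal :: "'v::set_universe \<Rightarrow> bool" where
  "is_cardinal \<kappa> \<longleftrightarrow> is_ordinal \<kappa> \<and> (\<forall>\<alpha>\<in>elts \<kappa>. \<not> elts \<alpha> \<approx> elts \<kappa>)"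

definition card_succ :: "'v::set_universe \<Rightarrow> 'v" where
  "card_succ \<kappa> = (THE \<mu>. is_cardinal \<mu> \<and> \<kappa> \<in> elts \<mu> \<and>
     (\<forall>\<nu>. is_cardinal \<nu> \<and> \<kappa> \<in> elts \<nu> \<longrightarrow> \<mu> = \<nu> \<or> \<mu> \<in> elts \<nu>))"

definition ord_succ :: "'v::set_universe \<Rightarrow> 'v" where
  "ord_succ \<alpha> = (THE \<beta>. elts \<beta> = insert \<alpha> (elts \<alpha>))"

definition has_order_type :: "'v::set_universe set \<Rightarrow> 'v \<Rightarrow> bool" where
  "has_order_type D \<beta> \<longleftrightarrow> is_ordinal \<beta> \<and>
     (\<exists>h. bij_betw h D (elts \<beta>) \<and> (\<forall>x\<in>D. \<forall>y\<in>D. x \<in> elts y \<longleftrightarrow> h x \<in> elts (h y)))"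


section \<open>Weak square\<close>

definition limit_point :: "'v::set_universe set \<Rightarrow> 'v \<Rightarrow> bool" where
  "limit_point D \<beta> \<longleftrightarrow>
     elts \<beta> \<noteq> {} \<and> (\<forall>\<gamma>\<in>elts \<beta>. \<exists>\<delta>\<in>D. \<gamma> \<in> elts \<delta> \<and> \<delta> \<in> elts \<beta>)"

text \<open>Unboundedness is weak (\<open>\<gamma> \<le> \<delta>\<close>), so that successor ordinals have closed unbounded subsets.\<close>

definition club_in :: "'v::set_universe set \<Rightarrow> 'v \<Rightarrow> bool" where
  "club_in D \<alpha> \<longleftrightarrow> D \<subseteq> elts \<alpha>
     \<and> (\<forall>\<gamma>\<in>elts \<alpha>. \<exists>\<delta>\<in>D. \<gamma> = \<delta> \<or> \<gamma> \<in> elts \<delta>)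
     \<and> (\<forall>\<beta>\<in>elts \<alpha>. limit_point D \<beta> \<longrightarrow> \<beta> \<in> D)"

definition weak_square :: "'v::set_universe \<Rightarrow> bool" where
  "weak_square \<kappa> \<longleftrightarrow> (\<exists>\<C> :: 'v \<Rightarrow> 'v set set.
     (\<forall>\<alpha>\<in>elts (card_succ \<kappa>).
        \<C> \<alpha> \<noteq> {} \<and> \<C> \<alpha> \<lesssim> elts \<kappa> \<and>
        (\<forall>D\<in>\<C> \<alpha>. club_in D \<alpha> \<and> (\<exists>\<beta>\<in>elts (ord_succ \<kappa>). has_order_type D \<beta>))) \<and>
     (\<forall>\<alpha>\<in>elts (card_succ \<kappa>). \<forall>D\<in>\<C> \<alpha>. \<forall>\<beta>\<in>elts \<alpha>.
        limit_point D \<beta> \<longrightarrow> D \<inter> elts \<beta> \<in> \<C> \<beta>))"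


section \<open>Chang's Conjecture\<close>

text \<open>
  First-order structures in a countable language: the symbols are natural numbers, constants are
  function symbols of arity 0.
\<close>

record 'a fo_structure =
  univ :: "'a set"
  fun_symbols :: "nat set"
  fun_arity :: "nat \<Rightarrow> nat"
  fun_interp :: "nat \<Rightarrow> 'a list \<Rightarrow> 'a"
  rel_symbols :: "nat set"
  rel_arity :: "nat \<Rightarrow> nat"
  rel_interp :: "nat \<Rightarrow> 'a list set"

definition tuples :: "'a set \<Rightarrow> nat \<Rightarrow> 'a list set" where
  "tuples A n = {xs. length xs = n \<and> set xs \<subseteq> A}"

definition is_structure :: "'a fo_structure \<Rightarrow> bool" where
  "is_structure \<AA> \<longleftrightarrow> univ \<AA> \<noteq> {}
     \<and> (\<forall>s\<in>fun_symbols \<AA>. \<forall>xs\<in>tuples (univ \<AA>) (fun_arity \<AA> s). fun_interp \<AA> s xs \<in> univ \<AA>)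
     \<and> (\<forall>s\<in>rel_symbols \<AA>. rel_interp \<AA> s \<subseteq> tuples (univ \<AA>) (rel_arity \<AA> s))"

definition substructure :: "'a fo_structure \<Rightarrow> 'a fo_structure \<Rightarrow> bool" where
  "substructure \<BB> \<AA> \<longleftrightarrow> is_structure \<BB> \<and> univ \<BB> \<subseteq> univ \<AA>
     \<and> fun_symbols \<BB> = fun_symbols \<AA> \<and> rel_symbols \<BB> = rel_symbols \<AA>
     \<and> (\<forall>s\<in>fun_symbols \<AA>. fun_arity \<BB> s = fun_arity \<AA> s \<and>
          (\<forall>xs\<in>tuples (univ \<BB>) (fun_arity \<AA> s). fun_interp \<BB> s xs = fun_interp \<AA> s xs))
     \<and> (\<forall>s\<in>rel_symbols \<AA>. rel_arity \<BB> s = rel_arity \<AA> s \<and>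
          rel_interp \<BB> s = rel_interp \<AA> s \<inter> tuples (univ \<BB>) (rel_arity \<AA> s))"

text \<open>\<open>chang \<kappa>1 \<kappa>0 \<mu>1 \<mu>0\<close> is the transfer property \<open>(\<kappa>1, \<kappa>0) ->> (\<mu>1, \<mu>0)\<close>.\<close>

definition chang :: "'v::set_universe \<Rightarrow> 'v \<Rightarrow> 'v \<Rightarrow> 'v \<Rightarrow> bool" where
  "chang \<kappa>1 \<kappa>0 \<mu>1 \<mu>0 \<longleftrightarrow>
     (\<forall>\<AA>. is_structure \<AA> \<and> univ \<AA> = elts \<kappa>1 \<longrightarrow>
        (\<exists>\<BB>. substructure \<BB> \<AA> \<and> univ \<BB> \<approx> elts \<mu>1 \<and> univ \<BB> \<inter> elts \<kappa>0 \<approx> elts \<mu>0))"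


section \<open>Ideals\<close>

definition ideal_on :: "'v set \<Rightarrow> 'v set set \<Rightarrow> bool" where
  "ideal_on Z I \<longleftrightarrow> I \<subseteq> Pow Z \<and> Z \<notin> I
     \<and> (\<forall>A\<in>I. \<forall>B. B \<subseteq> A \<longrightarrow> B \<in> I) \<and> (\<forall>A\<in>I. \<forall>B\<in>I. A \<union> B \<in> I)"

text \<open>\<open>Z\<close> is a collection of subsets of \<open>X\<close>, each given as an element of the universe.\<close>

definition normal_ideal_on :: "'v::set_universe set \<Rightarrow> 'v set \<Rightarrow> 'v set set \<Rightarrow> bool" where
  "normal_ideal_on X Z I \<longleftrightarrow> (\<forall>z\<in>Z. elts z \<subseteq> X) \<and> ideal_on Z I
     \<and> (\<forall>x\<in>X. {z\<in>Z. x \<notin> elts z} \<in> I)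
     \<and> (\<forall>A. (\<forall>x\<in>X. A x \<in> I) \<longrightarrow> {z\<in>Z. \<exists>x\<in>elts z. z \<in> A x} \<in> I)"


section \<open>Forcing with the Boolean algebra of subsets modulo an ideal\<close>

text \<open>
  The nonzero elements of \<open>P(Z)/I\<close> are represented by the \<open>I\<close>-positive subsets of \<open>Z\<close>; the class of
  \<open>q\<close> lies below the class of \<open>p\<close> iff \<open>q - p \<in> I\<close>. A sentence of the forcing language is identified
  with the set of conditions that force it, and the connectives are given by the usual clauses of
  the definition of (weak) forcing. The quantifiers range over (check names of) elements of \<open>S\<close>;
  every element of the generic ultrapower is the class of some function in V, so no other names
  are needed to speak about it.
\<close>

definition conditions :: "'v set \<Rightarrow> 'v set set \<Rightarrow> 'v set set" where
  "conditions Z I = {p. p \<subseteq> Z \<and> p \<notin> I}"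

definition below :: "'v set set \<Rightarrow> 'v set \<Rightarrow> 'v set \<Rightarrow> bool" where
  "below I q p \<longleftrightarrow> q - p \<in> I"

type_synonym 'v sentence = "'v set \<Rightarrow> bool"

definition forced :: "'v set \<Rightarrow> 'v set set \<Rightarrow> 'v sentence \<Rightarrow> bool" where
  "forced Z I \<phi> \<longleftrightarrow> (\<forall>p\<in>conditions Z I. \<phi> p)"

text \<open>\<open>A \<in> G\<close>; as the ordering is separative, \<open>p\<close> forces this iff \<open>p\<close> lies below \<open>A\<close>.\<close>

definition f_generic :: "'v set set \<Rightarrow> 'v set \<Rightarrow> 'v sentence" where
  "f_generic I A = (\<lambda>p. below I p A)"

definition f_and :: "'v sentence \<Rightarrow> 'v sentence \<Rightarrow> 'v sentence" where
  "f_and \<phi> \<psi> = (\<lambda>p. \<phi> p \<and> \<psi> p)"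

definition f_imp :: "'v set \<Rightarrow> 'v set set \<Rightarrow> 'v sentence \<Rightarrow> 'v sentence \<Rightarrow> 'v sentence" where
  "f_imp Z I \<phi> \<psi> = (\<lambda>p. \<forall>q\<in>conditions Z I. below I q p \<longrightarrow> \<phi> q \<longrightarrow> \<psi> q)"

definition f_all :: "'b set \<Rightarrow> ('b \<Rightarrow> 'v sentence) \<Rightarrow> 'v sentence" where
  "f_all S \<Phi> = (\<lambda>p. \<forall>x\<in>S. \<Phi> x p)"

definition f_ex :: "'v set \<Rightarrow> 'v set set \<Rightarrow> 'b set \<Rightarrow> ('b \<Rightarrow> 'v sentence) \<Rightarrow> 'v sentence" where
  "f_ex Z I S \<Phi> = (\<lambda>p. \<forall>q\<in>conditions Z I. below I q p \<longrightarrow>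
     (\<exists>r\<in>conditions Z I. below I r q \<and> (\<exists>x\<in>S. \<Phi> x r)))"

lemma f_and_mono [mono]:
  "(\<And>p. \<phi> p \<longrightarrow> \<phi>' p) \<Longrightarrow> (\<And>p. \<psi> p \<longrightarrow> \<psi>' p) \<Longrightarrow> f_and \<phi> \<psi> p \<longrightarrow> f_and \<phi>' \<psi>' p"
  by (auto simp: f_and_def)

lemma f_imp_mono [mono]:
  "(\<And>p. \<psi> p \<longrightarrow> \<psi>' p) \<Longrightarrow> f_imp Z I \<phi> \<psi> p \<longrightarrow> f_imp Z I \<phi> \<psi>' p"
  by (auto simp: f_imp_def)

lemma f_all_mono [mono]:
  "(\<And>x p. \<Phi> x p \<longrightarrow> \<Phi>' x p) \<Longrightarrow> f_all S \<Phi> p \<longrightarrow> f_all S \<Phi>' p"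
  by (auto simp: f_all_def)

lemma f_ex_mono [mono]:
  "(\<And>x p. \<Phi> x p \<longrightarrow> \<Phi>' x p) \<Longrightarrow> f_ex Z I S \<Phi> p \<longrightarrow> f_ex Z I S \<Phi>' p"
  unfolding f_ex_def by blast


section \<open>The generic ultrapower\<close>

text \<open>
  Elements of \<open>V\<^sup>Z/G\<close> are represented by functions, of which only the values on \<open>Z\<close> matter.
  \<open>ult_mem Z I f g\<close> is the sentence that \<open>[f]\<close> is a member of \<open>[g]\<close> in the ultrapower.
\<close>

definition ult_mem ::
    "'v::set_universe set \<Rightarrow> 'v set set \<Rightarrow> ('v \<Rightarrow> 'v) \<Rightarrow> ('v \<Rightarrow> 'v) \<Rightarrow> 'v sentence" where
  "ult_mem Z I f g = f_generic I {z\<in>Z. f z \<in> elts (g z)}"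

definition ult_embed :: "'v \<Rightarrow> ('v \<Rightarrow> 'v)" where
  "ult_embed x = (\<lambda>z. x)"

text \<open>
  \<open>ult_collapse Z I f x\<close> is the sentence that \<open>[f]\<close> lies in the well-founded part of \<open>V\<^sup>Z/G\<close> and that
  its image under the transitive collapse is the ground model set \<open>x\<close>, i.e. that every member of
  \<open>[f]\<close> collapses to a member of \<open>x\<close>, and every member of \<open>x\<close> is the collapse of a member of \<open>[f]\<close>.
  This is a recursion along the members of \<open>x\<close>; as membership in \<open>x\<close> is well-founded, the
  least fixed point is the only one.
\<close>

inductive ult_collapse ::
    "'v::set_universe set \<Rightarrow> 'v set set \<Rightarrow> ('v \<Rightarrow> 'v) \<Rightarrow> 'v \<Rightarrow> 'v sentence"
  for Z :: "'v set" and I :: "'v set set" where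
  "f_and
     (f_all UNIV (\<lambda>g. f_imp Z I (ult_mem Z I g f) (f_ex Z I (elts x) (\<lambda>y. ult_collapse Z I g y))))
     (f_all (elts x) (\<lambda>y. f_ex Z I UNIV (\<lambda>g. f_and (ult_mem Z I g f) (ult_collapse Z I g y)))) p
   \<Longrightarrow> ult_collapse Z I f x p"

text \<open>The sentence that the ground model set \<open>x\<close> is a member of the generic ultrapower.\<close>

definition in_ultrapower :: "'v::set_universe set \<Rightarrow> 'v set set \<Rightarrow> 'v \<Rightarrow> 'v sentence" where
  "in_ultrapower Z I x = f_ex Z I UNIV (\<lambda>f. ult_collapse Z I f x)"

text \<open>Well-founded up to \<open>\<delta>\<close>: every ordinal below \<open>\<delta>\<close> belongs to the (collapsed) well-founded part.\<close>

definition ult_wellfounded_upto :: "'v::set_universe set \<Rightarrow> 'v set set \<Rightarrow> 'v \<Rightarrow> 'v sentence" where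
  "ult_wellfounded_upto Z I \<delta> = f_all (elts \<delta>) (\<lambda>\<beta>. in_ultrapower Z I \<beta>)"

definition weakly_presaturated :: "'v::set_universe \<Rightarrow> 'v set set \<Rightarrow> bool" where
  "weakly_presaturated \<mu> I \<longleftrightarrow>
     (\<exists>\<kappa>. is_cardinal \<kappa> \<and> \<mu> = card_succ \<kappa>) \<and>
     normal_ideal_on (elts \<mu>) (elts \<mu>) I \<and>
     forced (elts \<mu>) I
       (f_and (ult_wellfounded_upto (elts \<mu>) I (ord_succ (card_succ \<mu>)))
              (ult_collapse (elts \<mu>) I (ult_embed \<mu>) (card_succ \<mu>)))"

end

theory Submission
  imports Defs
begin

text \<open>
  Write \<open>\<lambda> = \<kappa>\<^sup>+\<close>. Since \<open>2\<^sup>\<kappa> = \<lambda>\<close>, there are only \<open>\<lambda>\<close> subsets of \<open>\<lambda>\<close> of size at most \<open>\<kappa>\<close>, hence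
  only \<open>\<lambda>\<close> such subsets of each \<open>\<beta> < \<lambda>\<^sup>+\<close>; and each \<open>\<alpha> < \<lambda>\<^sup>+\<close> has a cofinal subset \<open>F\<^sub>\<alpha>\<close> of order type
  at most \<open>\<lambda>\<close> all of whose proper initial segments have size at most \<open>\<kappa>\<close>. This is a weak square
  at \<open>\<lambda>\<close>, up to taking closures, and either hypothesis lets it collapse to one at \<open>\<kappa>\<close>.

  Under Chang's Conjecture, let \<open>B\<close> be closed under the relevant functions, with \<open>B\<close> of size \<open>\<lambda>\<close> and
  \<open>B \<inter> \<lambda>\<close> of size \<open>\<kappa>\<close>. The collapse of \<open>B\<close> is \<open>\<lambda>\<close>, and the images of the sets \<open>F\<^sub>\<alpha> \<inter> B\<close> with \<open>\<alpha> \<in> B\<close> have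
  order types bounded by a fixed \<open>\<delta> < \<lambda>\<close> and, at each level, at most \<open>\<kappa>\<close> many initial segments.

  In the generic ultrapower \<open>M\<close>, the ordinal \<open>\<lambda>\<^sup>+\<close> is \<open>j(\<lambda>)\<close>, and \<open>M\<close> can define the family of the
  subsets of \<open>\<beta>\<close> lying in \<open>V\<close> and having size at most \<open>\<kappa>\<close> there, because some element of \<open>P(\<lambda>)\<^sup>V\<close> codes
  \<open>\<beta>\<close>; in \<open>M\<close> this family has size \<open>\<kappa>\<close>. Reflected to \<open>V\<close> without forcing: a function \<open>f\<close> representing
  \<open>P(\<lambda>)\<^sup>V\<close> assigns to almost every \<open>z < \<lambda>\<close> a family of codes for all the ordinals below \<open>\<lambda>\<close>, and the
  approximations at \<open>z\<close> are read off from these codes. A failure for positively many \<open>z\<close> would yield, by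
  pressing down and since every function into \<open>\<lambda>\<close> is somewhere equal to a canonical function, a failure
  at a fixed \<open>\<alpha> < \<lambda>\<^sup>+\<close>.

  From sets with order types bounded by \<open>\<delta>\<close> and few initial segments one gets order types at most \<open>\<kappa>\<close>
  by thinning along a cofinal subset of the order type, fixed once for each ordinal up to \<open>\<delta>\<close>.
\<close>

section \<open>Cardinality\<close>

lemma UN_lepoll:
  assumes "infinite B" "I \<lesssim> B" "\<And>i. i \<in> I \<Longrightarrow> A i \<lesssim> B"
  shows "(\<Union>i\<in>I. A i) \<lesssim> B"
  using assms card_of_UNION_ordLeq_infinite[of B I A] by (simp add: lepoll_def card_of_ordLeq)

lemma Times_lepoll:
  assumes "infinite C" "A \<lesssim> C" "B \<lesssim> C"
  shows "A \<times> B \<lesssim> C"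
proof -
  have "A \<times> B = (\<Union>a\<in>A. Pair a ` B)" by auto
  moreover have "Pair a ` B \<lesssim> C" for a
    using assms(3) image_lepoll lepoll_trans by blast
  ultimately show ?thesis using UN_lepoll[OF assms(1,2)] by metis
qed

lemma insert_lesspoll_infinite:
  assumes "infinite B" "A \<prec> B"
  shows "insert a A \<prec> B"
proof (cases "finite A")
  case True
  then show ?thesis using assms finite_lesspoll_infinite by blast
next
  case False
  show ?thesis by (rule eq_lesspoll_trans[OF infinite_insert_eqpoll[OF False] assms(2)])
qed

lemma insert_lepoll_infinite:
  assumes "infinite B" "A \<lesssim> B"
  shows "insert a A \<lesssim> B"
proof (cases "finite A")
  case True
  then show ?thesis using assms finite_lepoll_infinite by blast
next
  case False
  show ?thesis by (rule lepoll_trans1[OF infinite_insert_eqpoll[OF False] assms(2)])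
qed

lemma Pow_lepoll_mono:
  assumes "A \<lesssim> B"
  shows "Pow A \<lesssim> Pow B"
proof -
  obtain f where "inj_on f A" "f ` A \<subseteq> B" using assms by (auto simp: lepoll_def)
  then have "inj_on ((`) f) (Pow A)" "(`) f ` Pow A \<subseteq> Pow B"
    using inj_on_image_Pow by blast+
  then show ?thesis by (auto simp: lepoll_def)
qed

section \<open>Sets and ordinals of the universe\<close>

text \<open>An inverse of \<open>elts\<close>, unspecified when \<open>A\<close> is not a set of the
  universe; sethood is secured below by bounding \<open>A\<close> by an image or in
  cardinality.\<close>

definition set_of :: "'v::set_universe set \<Rightarrow> 'v" where
  "set_of A = (THE y. elts y = A)"

lemma elts_inject [simp]: "elts x = elts y \<longleftrightarrow> x = y"
  using extensionality by auto

lemma set_of_elts [simp]: "set_of (elts x) = x"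
  unfolding set_of_def by auto

lemma elts_set_of:
  fixes f :: "'v::set_universe \<Rightarrow> 'v"
  assumes "A \<subseteq> f ` elts x"
  shows "elts (set_of A) = A"
proof -
  obtain y where "elts y = f ` elts x" using replacement[of f x] by (rule exE)
  then have "A \<subseteq> elts y" using assms by simp
  then obtain z where z: "elts z = A" by (rule separation[THEN exE])
  show ?thesis unfolding z[symmetric] by simp
qed

lemma elts_set_of_subset: "A \<subseteq> elts x \<Longrightarrow> elts (set_of A) = A"
  using elts_set_of[of A id x] by simp

lemma elts_set_of_lepoll:
  fixes A :: "'v::set_universe set" and x :: 'v
  assumes "A \<lesssim> elts x"
  shows "elts (set_of A) = A"
proof -
  obtain g where "A \<subseteq> g ` elts x" using assms unfolding lepoll_iff by blast
  then show ?thesis by (rule elts_set_of)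
qed

lemma not_mem_self: "x \<notin> elts x"
  using wf_not_refl[OF foundation] by auto

lemma foundation_minimal:
  assumes "x \<in> Q"
  obtains y where "y \<in> Q" "\<And>z. z \<in> elts y \<Longrightarrow> z \<notin> Q"
  using wfE_min[OF foundation assms] by auto

lemmas mem_induct = wf_induct_rule[OF foundation, simplified]

lemma ordinal_mem: "is_ordinal a \<Longrightarrow> x \<in> elts a \<Longrightarrow> is_ordinal x"
  unfolding is_ordinal_def by blast

lemma ordinal_subset: "is_ordinal a \<Longrightarrow> x \<in> elts a \<Longrightarrow> elts x \<subseteq> elts a"
  unfolding is_ordinal_def by blast

lemma ordinal_trans: "is_ordinal a \<Longrightarrow> x \<in> elts a \<Longrightarrow> y \<in> elts x \<Longrightarrow> y \<in> elts a"
  unfolding is_ordinal_def by blast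

lemma is_ordinalI:
  assumes "\<And>x. x \<in> elts a \<Longrightarrow> is_ordinal x" "\<And>x. x \<in> elts a \<Longrightarrow> elts x \<subseteq> elts a"
  shows "is_ordinal a"
  using assms unfolding is_ordinal_def by blast

text \<open>Double induction along membership: if no alternative holds, the two induction hypotheses
  force each of \<open>a\<close> and \<open>b\<close> to be included in the other, so they are equal
  by extensionality.\<close>

lemma ordinal_linear:
  assumes "is_ordinal a" "is_ordinal b"
  shows "a \<in> elts b \<or> a = b \<or> b \<in> elts a"
  using assms
proof (induction a arbitrary: b rule: mem_induct)
  case (1 a)
  note IH = this
  show ?case using IH(3)
  proof (induction b rule: mem_induct)
    case (1 b)
    have oa: "is_ordinal a" and ob: "is_ordinal b" using IH(2) 1(2) .
    show ?case
    proof (rule ccontr)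
      assume neg: "\<not> ?thesis"
      have "elts a \<subseteq> elts b"
      proof
        fix x assume x: "x \<in> elts a"
        with IH(1)[OF x ordinal_mem[OF oa x] ob] neg ordinal_trans[OF oa x] show "x \<in> elts b" by blast
      qed
      moreover have "elts b \<subseteq> elts a"
      proof
        fix x assume x: "x \<in> elts b"
        with 1(1)[OF x ordinal_mem[OF ob x]] neg ordinal_trans[OF ob x] show "x \<in> elts a" by blast
      qed
      ultimately show False using neg extensionality by blast
    qed
  qed
qed

lemma ordinal_not_mem_iff:
  assumes "is_ordinal a" "is_ordinal b"
  shows "a \<notin> elts b \<longleftrightarrow> elts b \<subseteq> elts a"
  using ordinal_linear[OF assms] ordinal_subset assms not_mem_self by blast

lemma ordinal_least:
  assumes "is_ordinal x0" "P x0"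
  shows "\<exists>x. is_ordinal x \<and> P x \<and> (\<forall>y. is_ordinal y \<longrightarrow> P y \<longrightarrow> elts x \<subseteq> elts y)"
proof -
  have x: "x0 \<in> {x. is_ordinal x \<and> P x}" using assms by blast
  obtain y where "is_ordinal y" "P y" "\<And>z. z \<in> elts y \<Longrightarrow> \<not> (is_ordinal z \<and> P z)"
    by (rule foundation_minimal[OF x]) blast
  note y = this
  have "elts y \<subseteq> elts z" if "is_ordinal z" "P z" for z
    using ordinal_not_mem_iff[OF that(1) y(1)] y(3)[of z] that by blast
  then show ?thesis using y by blast
qed

lemma ordinal_least_of:
  assumes "x \<in> X" "\<And>x. x \<in> X \<Longrightarrow> is_ordinal x"
  obtains y where "y \<in> X" "\<And>z. z \<in> X \<Longrightarrow> elts y \<subseteq> elts z"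
  using ordinal_least[of x "\<lambda>x. x \<in> X"] assms by metis

lemma elts_ord_succ: "elts (ord_succ a) = insert a (elts a)"
proof -
  obtain u where u: "elts u = {a, a}" using pairing by blast
  obtain v where v: "elts v = {a, u}" using pairing by blast
  obtain w where w: "elts w = {u, a}" using pairing by blast
  obtain t where t: "elts t = (\<Union>y\<in>elts w. elts y)" using union by blast
  then have "elts t = insert a (elts a)" using u w by auto
  then show ?thesis unfolding ord_succ_def by (metis (mono_tags) elts_inject the_equality)
qed

section \<open>Mostowski collapse and order types\<close>

definition collapse :: "('v::set_universe \<times> 'v) set \<Rightarrow> 'v \<Rightarrow> 'v" where
  "collapse R = wfrec R (\<lambda>f x. set_of (f ` {y. (y, x) \<in> R}))"

lemma elts_collapse:
  assumes "wf R" "{y. (y, x) \<in> R} \<subseteq> elts u"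
  shows "elts (collapse R x) = collapse R ` {y. (y, x) \<in> R}"
proof -
  have "collapse R x = set_of (cut (collapse R) R x ` {y. (y, x) \<in> R})"
    unfolding collapse_def by (subst wfrec[OF assms(1)]) simp
  also have "cut (collapse R) R x ` {y. (y, x) \<in> R} = collapse R ` {y. (y, x) \<in> R}"
    by (auto simp: cut_def image_def)
  finally show ?thesis using assms(2) elts_set_of by (metis image_mono)
qed

text \<open>The isomorphism is the Mostowski collapse of \<open>R\<close>: transitivity of
  \<open>R\<close> makes its values ordinals, totality makes it injective on
  \<open>A\<close>.\<close>

lemma wellorder_iso_ordinal:
  fixes R :: "('v::set_universe \<times> 'v) set"
  assumes R: "wf R" "trans R" "\<And>x y. (x, y) \<in> R \<Longrightarrow> x \<in> A \<and> y \<in> A"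
    and total: "\<And>x y. x \<in> A \<Longrightarrow> y \<in> A \<Longrightarrow> (x, y) \<in> R \<or> x = y \<or> (y, x) \<in> R"
    and A: "A \<subseteq> elts u"
  shows "\<exists>(b::'v) h. is_ordinal b \<and> bij_betw h A (elts b)
    \<and> (\<forall>x\<in>A. \<forall>y\<in>A. (x, y) \<in> R \<longleftrightarrow> h x \<in> elts (h y))"
proof -
  let ?h = "collapse R"
  have elts_h: "elts (?h x) = ?h ` {y. (y, x) \<in> R}" for x
    by (rule elts_collapse[OF R(1), of _ u]) (use R(3) A in blast)
  have ord_h: "is_ordinal (?h x)" for x
    using R(1)
  proof (induction x rule: wf_induct_rule)
    case (less x)
    show ?case
    proof (rule is_ordinalI)
      fix z assume "z \<in> elts (?h x)"
      then show "is_ordinal z" using less elts_h by auto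
      obtain y where "(y, x) \<in> R" "z = ?h y" using \<open>z \<in> elts (?h x)\<close> elts_h by blast
      then show "elts z \<subseteq> elts (?h x)"
        using transD[OF R(2), of _ y x] elts_h[of x] elts_h[of y] by blast
    qed
  qed
  have mono: "?h x \<in> elts (?h y)" if "(x, y) \<in> R" for x y
    using that elts_h by auto
  have iff: "(x, y) \<in> R \<longleftrightarrow> ?h x \<in> elts (?h y)" if "x \<in> A" "y \<in> A" for x y
    using mono total[OF that] not_mem_self ordinal_trans[OF ord_h] by metis
  have inj: "inj_on ?h A"
    by (rule inj_onI) (metis total mono not_mem_self)
  let ?b = "set_of (?h ` A)"
  have b: "elts ?b = ?h ` A" by (rule elts_set_of[OF image_mono[OF A]])
  have "is_ordinal ?b"
  proof (rule is_ordinalI)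
    fix x assume "x \<in> elts ?b"
    then show "is_ordinal x" "elts x \<subseteq> elts ?b" using ord_h R(3) by (auto simp: b elts_h)
  qed
  moreover have "bij_betw ?h A (elts ?b)" using b inj unfolding bij_betw_def by blast
  ultimately show ?thesis using iff by blast
qed

lemma eqpoll_ordinal:
  fixes x :: "'v::set_universe"
  obtains b :: 'v where "is_ordinal b" "elts x \<approx> elts b"
proof -
  obtain r where r: "well_order_on (elts x) r" using well_order_on by blast
  let ?R = "r - Id"
  have lin: "linear_order_on (elts x) r" and wf: "wf ?R"
    using r by (auto simp: well_order_on_def)
  have tr: "trans ?R" and tot: "total_on (elts x) r" and sub: "r \<subseteq> elts x \<times> elts x"
    using lin by (auto simp: order_on_defs intro: trans_diff_Id)
  have "\<exists>(b::'v) h. is_ordinal b \<and> bij_betw h (elts x) (elts b)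
    \<and> (\<forall>y\<in>elts x. \<forall>z\<in>elts x. (y, z) \<in> ?R \<longleftrightarrow> h y \<in> elts (h z))"
  proof (rule wellorder_iso_ordinal[OF wf tr, of "elts x" x])
    show "(y, z) \<in> ?R \<Longrightarrow> y \<in> elts x \<and> z \<in> elts x" for y z using sub by blast
    show "y \<in> elts x \<Longrightarrow> z \<in> elts x \<Longrightarrow> (y, z) \<in> ?R \<or> y = z \<or> (z, y) \<in> ?R" for y z
      using tot unfolding total_on_def by blast
  qed simp
  then show thesis using that unfolding eqpoll_def by blast
qed

text \<open>The collapse of membership restricted to \<open>D\<close>. For a set \<open>D\<close> of
  ordinals, \<open>otp D x\<close> is the order type of the part of \<open>D\<close> below
  \<open>x\<close>, whether or not \<open>x\<close> is in \<open>D\<close>; so one function gives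
  both the collapsing map on \<open>D\<close> and, at an upper bound, the order type of
  \<open>D\<close>.\<close>

definition otp :: "'v::set_universe set \<Rightarrow> 'v \<Rightarrow> 'v" where
  "otp D = collapse {(y, x). y \<in> D \<and> y \<in> elts x}"

lemma elts_otp: "elts (otp D x) = otp D ` (D \<inter> elts x)"
proof -
  have "wf {(y, x). y \<in> D \<and> y \<in> elts x}"
    by (rule wf_subset[OF foundation]) auto
  then have "elts (otp D x) = otp D ` {y. (y, x) \<in> {(y, x). y \<in> D \<and> y \<in> elts x}}"
    unfolding otp_def by (rule elts_collapse[of _ _ x]) auto
  also have "{y. (y, x) \<in> {(y, x). y \<in> D \<and> y \<in> elts x}} = D \<inter> elts x" by auto
  finally show ?thesis .
qed

lemma otp_mono:
  assumes "y \<in> D" "y \<in> elts x"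
  shows "otp D y \<in> elts (otp D x)"
  using assms by (auto simp: elts_otp)

lemma otp_ordinal:
  assumes "is_ordinal x"
  shows "is_ordinal (otp D x)"
  using assms
proof (induction x rule: mem_induct)
  case (1 x)
  show ?case
  proof (rule is_ordinalI)
    fix z assume z: "z \<in> elts (otp D x)"
    then show "is_ordinal z" using 1 ordinal_mem by (auto simp: elts_otp)
    show "elts z \<subseteq> elts (otp D x)"
      using z ordinal_trans[OF 1(2)] by (auto simp: elts_otp)
  qed
qed

lemma otp_cong:
  assumes "is_ordinal x" "D \<inter> elts x = D' \<inter> elts x"
  shows "otp D x = otp D' x"
  using assms
proof (induction x rule: mem_induct)
  case (1 x)
  have "otp D y = otp D' y" if "y \<in> elts x" for y
    using 1 that ordinal_mem[OF 1(2)] ordinal_subset[OF 1(2)] by blast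
  then have "otp D ` (D \<inter> elts x) = otp D' ` (D' \<inter> elts x)"
    unfolding 1(3) by (auto intro: image_cong)
  then show ?case by (metis elts_otp extensionality)
qed

lemma otp_mem_iff:
  assumes "x \<in> D" "y \<in> D" "is_ordinal x" "is_ordinal y"
  shows "otp D x \<in> elts (otp D y) \<longleftrightarrow> x \<in> elts y"
  using assms otp_mono otp_ordinal ordinal_linear ordinal_trans not_mem_self by metis

lemma otp_inj_on:
  assumes "\<And>x. x \<in> D \<Longrightarrow> is_ordinal x"
  shows "inj_on (otp D) D"
  by (rule inj_onI) (metis assms ordinal_linear otp_mono not_mem_self)

lemma otp_eqpoll:
  assumes "\<And>x. x \<in> D \<Longrightarrow> is_ordinal x"
  shows "elts (otp D x) \<approx> D \<inter> elts x"
  unfolding elts_otp using otp_inj_on[OF assms] inj_on_image_eqpoll_self inj_on_subset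
  by (metis Int_lower1)

text \<open>The collapse is the least strictly increasing map into the ordinals; hence a bound on
  any such map bounds the order type.\<close>

lemma otp_least:
  assumes "\<And>y. y \<in> D \<Longrightarrow> is_ordinal (g y)"
    and "\<And>y z. y \<in> D \<Longrightarrow> z \<in> D \<Longrightarrow> y \<in> elts z \<Longrightarrow> g y \<in> elts (g z)"
    and "x \<in> D" "is_ordinal x"
  shows "elts (otp D x) \<subseteq> elts (g x)"
  using assms(3,4)
proof (induction x rule: mem_induct)
  case (1 x)
  show ?case
  proof
    fix z assume "z \<in> elts (otp D x)"
    then obtain y where y: "y \<in> D" "y \<in> elts x" "z = otp D y" by (auto simp: elts_otp)
    then have "elts z \<subseteq> elts (g y)" "is_ordinal z"
      using 1 ordinal_mem otp_ordinal by blast+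
    moreover have "g y \<in> elts (g x)" using assms(2) y 1 by blast
    ultimately show "z \<in> elts (g x)"
      using assms(1)[OF y(1)] assms(1)[OF 1(2)] ordinal_not_mem_iff ordinal_trans ordinal_linear
      by (metis not_mem_self subset_iff)
  qed
qed

text \<open>An ordinal is transitive, so an isomorphism onto it satisfies the recursion that defines
  the collapse.\<close>

lemma iso_eq_otp:
  assumes k: "bij_betw k D (elts b)" and b: "is_ordinal b"
    and iff: "\<And>x y. x \<in> D \<Longrightarrow> y \<in> D \<Longrightarrow> x \<in> elts y \<longleftrightarrow> k x \<in> elts (k y)"
    and "x \<in> D"
  shows "k x = otp D x"
  using \<open>x \<in> D\<close>
proof (induction x rule: mem_induct)
  case (1 x)
  have "elts (k x) \<subseteq> k ` D"
    using k ordinal_subset[OF b] 1(2) unfolding bij_betw_def by blast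
  then have "elts (k x) = k ` (D \<inter> elts x)" using iff 1(2) by blast
  also have "\<dots> = otp D ` (D \<inter> elts x)" using 1(1) by auto
  finally show ?case by (metis elts_otp extensionality)
qed

lemma has_order_type_otp:
  assumes "is_ordinal a" "D \<subseteq> elts a"
  shows "has_order_type D (otp D a)"
proof -
  have ord: "is_ordinal x" if "x \<in> D" for x using assms that ordinal_mem by blast
  have "bij_betw (otp D) D (elts (otp D a))"
    unfolding bij_betw_def elts_otp using assms(2) ord by (auto intro: otp_inj_on simp: Int_absorb2)
  then show ?thesis
    unfolding has_order_type_def using otp_ordinal[OF assms(1)] otp_mem_iff ord by metis
qed

section \<open>Cardinals\<close>

lemma cardinal_lepoll_iff:
  assumes "is_cardinal k" "is_ordinal a"
  shows "elts a \<prec> elts k \<longleftrightarrow> a \<in> elts k"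
proof
  assume "elts a \<prec> elts k"
  then have "\<not> elts k \<lesssim> elts a" using lepoll_antisym lesspoll_def by blast
  then have "\<not> elts k \<subseteq> elts a" using subset_imp_lepoll by blast
  then show "a \<in> elts k" using ordinal_not_mem_iff assms is_cardinal_def by blast
next
  assume "a \<in> elts k"
  then show "elts a \<prec> elts k"
    using assms ordinal_subset[of k a] subset_imp_lepoll[of "elts a" "elts k"]
    unfolding lesspoll_def is_cardinal_def by blast
qed

text \<open>To justify the definite description: by Cantor, an ordinal equinumerous with a power set
  of \<open>k\<close> does not inject into \<open>k\<close>, and the least ordinal that does not is
  the successor cardinal.\<close>

lemma card_succ:
  fixes k :: "'v::set_universe"
  assumes k: "is_cardinal k" and p: "elts p = {z. elts z \<subseteq> elts k}"
  shows "is_cardinal (card_succ k)"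
    and "elts (card_succ k) = {a::'v. is_ordinal a \<and> elts a \<lesssim> elts k}"
proof -
  have "Pow (elts k) \<lesssim> elts p"
  proof -
    have "inj_on set_of (Pow (elts k))"
      by (rule inj_onI) (metis elts_set_of_subset PowD)
    moreover have "set_of ` Pow (elts k) \<subseteq> elts p"
      using p by (auto simp: elts_set_of_subset)
    ultimately show ?thesis by (auto simp: lepoll_def)
  qed
  moreover obtain b :: 'v where b: "is_ordinal b" "elts p \<approx> elts b" by (rule eqpoll_ordinal)
  ultimately have "elts k \<prec> elts b"
    using lesspoll_trans2[OF lesspoll_Pow_self] lepoll_trans2 by blast
  then have big: "\<not> elts b \<lesssim> elts k"
    using lesspoll_trans2 lesspoll_not_refl by blast
  obtain m :: 'v where m: "is_ordinal m" "\<not> elts m \<lesssim> elts k"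
      "\<And>y. is_ordinal y \<Longrightarrow> \<not> elts y \<lesssim> elts k \<Longrightarrow> elts m \<subseteq> elts y"
    using ordinal_least[of b "\<lambda>x. \<not> elts x \<lesssim> elts k", OF b(1) big] by metis
  have ok: "is_ordinal k" using k is_cardinal_def by blast
  have elts_m: "elts m = {a. is_ordinal a \<and> elts a \<lesssim> elts k}"
  proof (intro set_eqI iffI)
    fix a assume "a \<in> elts m"
    then show "a \<in> {a. is_ordinal a \<and> elts a \<lesssim> elts k}"
      using m ordinal_mem ordinal_not_mem_iff not_mem_self by blast
  next
    fix a :: 'v assume a: "a \<in> {a. is_ordinal a \<and> elts a \<lesssim> elts k}"
    have "\<not> elts m \<subseteq> elts a"
      using a m(2) subset_imp_lepoll lepoll_trans by blast
    then show "a \<in> elts m" using ordinal_not_mem_iff a m by blast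
  qed
  have card: "is_cardinal m"
    unfolding is_cardinal_def
  proof (intro conjI ballI notI m(1))
    fix a assume a: "a \<in> elts m" "elts a \<approx> elts m"
    then have "elts m \<lesssim> elts k" using elts_m lepoll_trans1[OF eqpoll_sym] by blast
    then show False using m(2) by blast
  qed
  have least: "m = n \<or> m \<in> elts n" if n: "is_cardinal n" "k \<in> elts n" for n
  proof -
    have "elts k \<prec> elts n" using cardinal_lepoll_iff n ok by blast
    then have "\<not> elts n \<lesssim> elts k" using lepoll_antisym lesspoll_def by blast
    then have "elts m \<subseteq> elts n" using m(3) n is_cardinal_def by blast
    then show ?thesis using ordinal_linear m(1) n(1) not_mem_self unfolding is_cardinal_def by blast
  qed
  have "k \<in> elts m" using elts_m ok by blast
  then have "card_succ k = m"
    unfolding card_succ_def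
    by (intro the_equality) (use card least not_mem_self ordinal_trans m(1) in blast)+
  then show "is_cardinal (card_succ k)" "elts (card_succ k) = {a. is_ordinal a \<and> elts a \<lesssim> elts k}"
    using card elts_m by auto
qed

text \<open>Enumerate \<open>a\<close> by \<open>g\<close> along \<open>k\<close> and let
  \<open>F\<close> consist of the record values, those exceeding all earlier values in
  \<open>a\<close>. The first index with value at least \<open>x\<close> is a record, so
  \<open>F\<close> is cofinal; smaller records have earlier indices, so initial segments of
  \<open>F\<close> are short.\<close>

lemma short_cofinal_subset:
  fixes k a :: "'v::set_universe"
  assumes k: "is_ordinal k" and a: "is_ordinal a" "elts a \<lesssim> elts k"
  obtains F where "F \<subseteq> elts a" "\<And>x. x \<in> elts a \<Longrightarrow> \<exists>y\<in>F. elts x \<subseteq> elts y"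
    "\<And>x. x \<in> elts a \<Longrightarrow> \<exists>i\<in>elts k. F \<inter> elts x \<lesssim> elts i"
proof -
  obtain g where g: "elts a \<subseteq> g ` elts k" using a(2) lepoll_iff by metis
  define N where "N = {i \<in> elts k. g i \<in> elts a \<and> (\<forall>j\<in>elts i. g j \<in> elts a \<longrightarrow> g j \<in> elts (g i))}"
  define F where "F = g ` N"
  have ordk: "is_ordinal i" if "i \<in> elts k" for i using that k ordinal_mem by blast
  have orda: "is_ordinal i" if "i \<in> elts a" for i using that a ordinal_mem by blast
  have cof: "\<exists>y\<in>F. elts x \<subseteq> elts y" if x: "x \<in> elts a" for x
  proof -
    let ?X = "{i \<in> elts k. g i \<in> elts a \<and> elts x \<subseteq> elts (g i)}"
    obtain i0 where "i0 \<in> ?X" using g x by blast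
    then obtain i where i: "i \<in> ?X" "\<And>j. j \<in> ?X \<Longrightarrow> elts i \<subseteq> elts j"
      using ordinal_least_of[of i0 ?X] ordk by blast
    have "g j \<in> elts (g i)" if j: "j \<in> elts i" "g j \<in> elts a" for j
    proof -
      have "j \<notin> ?X" using i(2) j(1) not_mem_self by blast
      then have "\<not> elts x \<subseteq> elts (g j)" using j i(1) ordinal_trans[OF k] by blast
      then have "g j \<in> elts x" using orda[OF x] orda[OF j(2)] ordinal_not_mem_iff by blast
      then show ?thesis using i(1) by blast
    qed
    then have "i \<in> N" using i(1) unfolding N_def by blast
    then show ?thesis using i(1) unfolding F_def by blast
  qed
  have small: "\<exists>i\<in>elts k. F \<inter> elts x \<lesssim> elts i" if x: "x \<in> elts a" for x
  proof -
    obtain y where y: "y \<in> F" "elts x \<subseteq> elts y" using cof x by blast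
    then obtain i where i: "i \<in> N" "y = g i" unfolding F_def by blast
    have "F \<inter> elts x \<subseteq> g ` elts i"
    proof
      fix w assume w: "w \<in> F \<inter> elts x"
      then obtain j where j: "j \<in> N" "w = g j" unfolding F_def by blast
      have wi: "g j \<in> elts (g i)" using w y i j by blast
      have "j \<in> elts i"
      proof (rule ccontr)
        assume "j \<notin> elts i"
        then have "j = i \<or> i \<in> elts j" using ordinal_linear ordk i(1) j(1) unfolding N_def by blast
        then have ij: "g i = g j \<or> g i \<in> elts (g j)" using i j unfolding N_def by blast
        have "is_ordinal (g i)" using orda i(1) unfolding N_def by blast
        then show False using wi ij not_mem_self[of "g i"] ordinal_trans[of "g i" "g j" "g i"] by auto
      qed
      then show "w \<in> g ` elts i" using j by blast
    qed
    then show ?thesis using i(1) subset_image_lepoll unfolding N_def by blast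
  qed
  show thesis using that[of F] cof small unfolding F_def N_def by blast
qed

text \<open>By regularity of the successor cardinal \<open>l\<close>, each such \<open>X\<close> is
  included in some ordinal below \<open>l\<close>. There are \<open>l\<close> many of these
  ordinals, and each has at most \<open>l\<close> subsets.\<close>

lemma card_bounded_subsets:
  fixes k l :: "'v::set_universe"
  assumes k: "infinite (elts k)" "is_ordinal k"
    and l: "elts l = {a. is_ordinal a \<and> elts a \<lesssim> elts k}" and pow: "Pow (elts k) \<lesssim> elts l"
  shows "{X. X \<subseteq> elts l \<and> X \<lesssim> elts k} \<lesssim> elts l"
proof -
  have "elts k \<prec> elts l" by (rule lesspoll_trans2[OF lesspoll_Pow_self pow])
  then have inf: "infinite (elts l)"
    using k(1) unfolding infinite_le_lepoll by (blast intro: lepoll_trans lesspoll_imp_lepoll)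
  have "X \<in> (\<Union>b\<in>elts l. Pow (elts b))" if X: "X \<subseteq> elts l" "X \<lesssim> elts k" for X
  proof -
    \<comment> \<open>The least ordinal including \<open>X\<close>: a union of at most
      \<open>k\<close> many ordinals of size at most \<open>k\<close>.\<close>
    let ?U = "\<Union>x\<in>X. insert x (elts x)"
    have "?U \<lesssim> elts k"
    proof (rule UN_lepoll[OF k(1) X(2)])
      fix x assume "x \<in> X"
      then have "elts x \<lesssim> elts k" using X(1) l by blast
      then show "insert x (elts x) \<lesssim> elts k" by (rule insert_lepoll_infinite[OF k(1)])
    qed
    then have U: "elts (set_of ?U) = ?U" by (rule elts_set_of_lepoll)
    have "is_ordinal (set_of ?U)"
    proof (rule is_ordinalI; unfold U)
      fix y assume "y \<in> ?U"
      then obtain x where x: "x \<in> X" "y = x \<or> y \<in> elts x" by blast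
      then have "is_ordinal x" using X(1) l by blast
      then show "is_ordinal y" "elts y \<subseteq> ?U"
        using x ordinal_mem[of x y] ordinal_subset[of x y] by blast+
    qed
    then have "set_of ?U \<in> elts l" using l U \<open>?U \<lesssim> elts k\<close> by auto
    then show ?thesis using U by blast
  qed
  then have "{X. X \<subseteq> elts l \<and> X \<lesssim> elts k} \<subseteq> (\<Union>b\<in>elts l. Pow (elts b))" by blast
  moreover have "(\<Union>b\<in>elts l. Pow (elts b)) \<lesssim> elts l"
  proof (rule UN_lepoll[OF inf lepoll_refl])
    fix b assume "b \<in> elts l"
    then have "elts b \<lesssim> elts k" using l by blast
    then show "Pow (elts b) \<lesssim> elts l" by (rule lepoll_trans[OF Pow_lepoll_mono pow])
  qed
  ultimately show ?thesis by (rule lepoll_trans[OF subset_imp_lepoll])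
qed

section \<open>Weak square from short approximations\<close>

definition thin :: "'v::set_universe set \<Rightarrow> 'v set \<Rightarrow> 'v set" where
  "thin D F = {x \<in> D. otp D x \<in> F}"

definition clo :: "'v::set_universe set \<Rightarrow> 'v \<Rightarrow> 'v set" where
  "clo D b = {x \<in> elts b. x \<in> D \<or> limit_point D x}"

lemma thin_subset: "thin D F \<subseteq> D"
  by (auto simp: thin_def)

text \<open>The position in \<open>D\<close> of a point below \<open>b\<close> is computed from the
  part of \<open>D\<close> below \<open>b\<close>. Hence initial segments of a thinned set depend
  only on initial segments of \<open>D\<close>, which keeps their number small.\<close>

lemma thin_Int:
  assumes "is_ordinal b"
  shows "thin D F \<inter> elts b = thin (D \<inter> elts b) F"
proof -
  have "otp D x = otp (D \<inter> elts b) x" if "x \<in> elts b" for x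
    by (rule otp_cong[OF ordinal_mem[OF assms that]])
       (use ordinal_subset[OF assms that] in blast)
  then show ?thesis unfolding thin_def by auto
qed

lemma limit_point_Int:
  assumes "is_ordinal b" "x \<in> elts b"
  shows "limit_point (D \<inter> elts b) x \<longleftrightarrow> limit_point D x"
  using ordinal_subset[OF assms] unfolding limit_point_def by blast

lemma clo_Int_left:
  assumes "is_ordinal b"
  shows "clo (D \<inter> elts b) b = clo D b"
  unfolding clo_def using limit_point_Int[OF assms] by blast

lemma clo_Int:
  assumes "is_ordinal a" "b \<in> elts a"
  shows "clo D a \<inter> elts b = clo D b"
  unfolding clo_def using ordinal_subset[OF assms] by blast

lemma limit_point_clo:
  assumes a: "is_ordinal a" and x: "is_ordinal x" and lim: "limit_point (clo D a) x"
  shows "limit_point D x"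
  unfolding limit_point_def
proof (intro conjI ballI)
  show "elts x \<noteq> {}" using lim unfolding limit_point_def by blast
  fix y assume "y \<in> elts x"
  then obtain z where z: "z \<in> clo D a" "y \<in> elts z" "z \<in> elts x"
    using lim unfolding limit_point_def by blast
  show "\<exists>z\<in>D. y \<in> elts z \<and> z \<in> elts x"
  proof (cases "z \<in> D")
    case False
    then have "limit_point D z" using z(1) unfolding clo_def by blast
    then obtain w where "w \<in> D" "y \<in> elts w" "w \<in> elts z"
      using z(2) unfolding limit_point_def by blast
    then show ?thesis using ordinal_trans[OF x z(3)] by blast
  qed (use z in blast)
qed

text \<open>Send a point of the closure below \<open>x\<close> to the least larger member of
  \<open>X\<close> below \<open>x\<close>, or to \<open>x\<close> if there is none. This is
  injective, since for points g < h of the closure some u in \<open>X\<close> satisfies g < u \<le>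
  h.\<close>

lemma clo_initial_lesspoll:
  fixes a k :: "'v::set_universe"
  assumes a: "is_ordinal a" and X: "X \<subseteq> elts a" "\<And>x. x \<in> elts a \<Longrightarrow> \<exists>y\<in>X. elts x \<subseteq> elts y"
    and small: "\<And>x. x \<in> X \<Longrightarrow> X \<inter> elts x \<prec> elts k" and k: "infinite (elts k)"
    and x: "x \<in> elts a"
  shows "clo X a \<inter> elts x \<prec> elts k"
proof -
  define T where "T = insert x (X \<inter> elts x)"
  obtain y where y: "y \<in> X" "elts x \<subseteq> elts y" using X(2) x by blast
  have "X \<inter> elts x \<lesssim> X \<inter> elts y" using y(2) by (intro subset_imp_lepoll) blast
  then have "X \<inter> elts x \<prec> elts k" using small[OF y(1)] lesspoll_trans1 by blast
  then have T: "T \<prec> elts k" unfolding T_def by (rule insert_lesspoll_infinite[OF k])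
  have ordT: "is_ordinal t" if "t \<in> T" for t
    using that X(1) x ordinal_mem[OF a] unfolding T_def by blast
  have ex: "\<exists>t. t \<in> T \<and> g \<in> elts t \<and> (\<forall>u. u \<in> T \<and> g \<in> elts u \<longrightarrow> elts t \<subseteq> elts u)"
    if "g \<in> elts x" for g
  proof -
    have "x \<in> {t \<in> T. g \<in> elts t}" using that unfolding T_def by blast
    then obtain t where "t \<in> {t \<in> T. g \<in> elts t}"
        "\<And>u. u \<in> {t \<in> T. g \<in> elts t} \<Longrightarrow> elts t \<subseteq> elts u"
      by (rule ordinal_least_of) (use ordT in blast)+
    then show ?thesis by blast
  qed
  then obtain s where s: "\<And>g. g \<in> elts x \<Longrightarrow> s g \<in> T" "\<And>g. g \<in> elts x \<Longrightarrow> g \<in> elts (s g)"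
      "\<And>g u. g \<in> elts x \<Longrightarrow> u \<in> T \<Longrightarrow> g \<in> elts u \<Longrightarrow> elts (s g) \<subseteq> elts u"
    by metis
  have neq: "s g \<noteq> s h" if g: "g \<in> elts x" and h: "h \<in> clo X a \<inter> elts x" and gh: "g \<in> elts h" for g h
  proof -
    have hx: "h \<in> elts x" and oh: "is_ordinal h" "is_ordinal x"
      using h x ordinal_mem[OF a] ordinal_mem[of x h] by blast+
    obtain u where u: "u \<in> X" "g \<in> elts u" "elts u \<subseteq> elts h" "u \<in> elts x"
    proof (cases "h \<in> X")
      case True then show thesis using that gh hx by blast
    next
      case False
      then have "limit_point X h" using h unfolding clo_def by blast
      then obtain u where "u \<in> X" "g \<in> elts u" "u \<in> elts h"
        using gh unfolding limit_point_def by blast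
      then show thesis using that ordinal_subset[OF oh(1)] ordinal_trans[OF oh(2) hx] by blast
    qed
    then have "elts (s g) \<subseteq> elts h" using s(3)[OF g, of u] unfolding T_def by blast
    then show ?thesis using s(2)[OF hx] not_mem_self[of h] by auto
  qed
  have "inj_on s (clo X a \<inter> elts x)"
  proof (rule inj_onI)
    fix g h assume gh: "g \<in> clo X a \<inter> elts x" "h \<in> clo X a \<inter> elts x" "s g = s h"
    then have "is_ordinal g" "is_ordinal h" using ordinal_mem[OF a] unfolding clo_def by blast+
    then show "g = h" using neq gh ordinal_linear[of g h] by (metis IntD2)
  qed
  moreover have "s ` (clo X a \<inter> elts x) \<subseteq> T" using s(1) by blast
  ultimately have "clo X a \<inter> elts x \<lesssim> T" unfolding lepoll_def by blast
  then show ?thesis using T lesspoll_trans1 by blast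
qed

text \<open>The members of the order type are the order types of proper initial segments, which are
  ordinals of size less than the cardinal \<open>k\<close>, hence below \<open>k\<close>.\<close>

lemma otp_le_cardinal:
  fixes a k :: "'v::set_universe"
  assumes k: "is_cardinal k" and a: "is_ordinal a" and D: "D \<subseteq> elts a"
    and small: "\<And>x. x \<in> D \<Longrightarrow> D \<inter> elts x \<prec> elts k"
  shows "\<exists>b\<in>elts (ord_succ k). has_order_type D b"
proof -
  have ok: "is_ordinal k" using k is_cardinal_def by blast
  have ord: "is_ordinal x" if "x \<in> D" for x using that D ordinal_mem[OF a] by blast
  have "elts (otp D a) \<subseteq> elts k"
  proof
    fix z assume "z \<in> elts (otp D a)"
    then obtain x where x: "x \<in> D" "z = otp D x" by (auto simp: elts_otp)
    have "elts z \<prec> elts k"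
      using otp_eqpoll[OF ord, of D x] small[OF x(1)] eq_lesspoll_trans unfolding x(2) by blast
    then show "z \<in> elts k" using cardinal_lepoll_iff[OF k] otp_ordinal[OF ord[OF x(1)]] x(2) by blast
  qed
  then have "k \<notin> elts (otp D a)" using not_mem_self by blast
  then have "otp D a \<in> elts (ord_succ k)"
    using ordinal_linear[OF ok otp_ordinal[OF a]] by (auto simp: elts_ord_succ)
  then show ?thesis using has_order_type_otp[OF a D] by blast
qed

lemma thin_cofinal:
  fixes a k :: "'v::set_universe"
  assumes a: "is_ordinal a" and E: "E \<subseteq> elts a" "\<And>x. x \<in> elts a \<Longrightarrow> \<exists>y\<in>E. elts x \<subseteq> elts y"
    and F: "F \<subseteq> elts (otp E a)" "\<And>x. x \<in> elts (otp E a) \<Longrightarrow> \<exists>y\<in>F. elts x \<subseteq> elts y"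
    and x: "x \<in> elts a"
  shows "\<exists>y\<in>thin E F. elts x \<subseteq> elts y"
proof -
  have ord: "is_ordinal x" if "x \<in> E" for x using that E(1) ordinal_mem[OF a] by blast
  obtain y where y: "y \<in> E" "elts x \<subseteq> elts y" using E(2) x by blast
  then have "otp E y \<in> elts (otp E a)" using E(1) otp_mono by blast
  then obtain i where i: "i \<in> F" "elts (otp E y) \<subseteq> elts i" using F(2) by blast
  then obtain z where z: "z \<in> E" "i = otp E z" using F(1) by (auto simp: elts_otp)
  have "z \<notin> elts y"
    using otp_mono[OF z(1), of y] i(2) z(2) not_mem_self by blast
  then have "elts y \<subseteq> elts z" using ordinal_not_mem_iff ord y z by blast
  then show ?thesis using y z i unfolding thin_def by blast
qed

lemma thin_initial_lepoll:
  assumes "\<And>x. x \<in> E \<Longrightarrow> is_ordinal x"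
  shows "thin E F \<inter> elts x \<lesssim> F \<inter> elts (otp E x)"
proof -
  have "inj_on (otp E) (thin E F \<inter> elts x)"
    using otp_inj_on[OF assms, of E] by (rule inj_on_subset) (auto simp: thin_def)
  moreover have "otp E ` (thin E F \<inter> elts x) \<subseteq> F \<inter> elts (otp E x)"
    using otp_mono by (auto simp: thin_def)
  ultimately show ?thesis unfolding lepoll_def by blast
qed

section \<open>Construction of the weak square sequence\<close>

proposition weak_square_if_approximations:
  fixes k d :: "'v::set_universe" and S :: "'v \<Rightarrow> 'v set set"
  assumes k: "is_cardinal k" "infinite (elts k)"
    and l: "elts (card_succ k) = {a. is_ordinal a \<and> elts a \<lesssim> elts k}"
    and d: "d \<in> elts (card_succ k)"
    and S: "\<And>a. a \<in> elts (card_succ k) \<Longrightarrow> S a \<lesssim> elts k"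
    and E: "\<And>a. a \<in> elts (card_succ k) \<Longrightarrow> \<exists>E g. E \<subseteq> elts a \<and> (\<forall>x\<in>elts a. \<exists>y\<in>E. elts x \<subseteq> elts y)
      \<and> g ` E \<subseteq> elts d \<and> (\<forall>y\<in>E. \<forall>z\<in>E. y \<in> elts z \<longrightarrow> g y \<in> elts (g z))
      \<and> (\<forall>b\<in>elts a. E \<inter> elts b \<in> S b)"
  shows "weak_square k"
proof -
  define l where "l = card_succ k"
  have l: "a \<in> elts l \<longleftrightarrow> is_ordinal a \<and> elts a \<lesssim> elts k" for a
    unfolding l_def assms(3) by blast
  have ord: "is_ordinal a" if "a \<in> elts l" for a using that l by blast
  have ok: "is_ordinal k" using k is_cardinal_def by blast
  have trans_l: "b \<in> elts l" if "a \<in> elts l" "b \<in> elts a" for a b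
    using that l[of a] l[of b] ordinal_mem ordinal_subset subset_imp_lepoll lepoll_trans by metis
  have d: "is_ordinal d" "elts d \<lesssim> elts k" using d l l_def by blast+
  obtain E g where E: "\<And>a. a \<in> elts l \<Longrightarrow> E a \<subseteq> elts a"
      "\<And>a x. a \<in> elts l \<Longrightarrow> x \<in> elts a \<Longrightarrow> \<exists>y\<in>E a. elts x \<subseteq> elts y"
      "\<And>a b. a \<in> elts l \<Longrightarrow> b \<in> elts a \<Longrightarrow> E a \<inter> elts b \<in> S b"
    and g: "\<And>a y. a \<in> elts l \<Longrightarrow> y \<in> E a \<Longrightarrow> g a y \<in> elts d"
      "\<And>a y z. a \<in> elts l \<Longrightarrow> y \<in> E a \<Longrightarrow> z \<in> E a \<Longrightarrow> y \<in> elts z \<Longrightarrow> g a y \<in> elts (g a z)"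
  proof -
    define P where "P a E g \<longleftrightarrow> E \<subseteq> elts a \<and> (\<forall>x\<in>elts a. \<exists>y\<in>E. elts x \<subseteq> elts y)
      \<and> g ` E \<subseteq> elts d \<and> (\<forall>y\<in>E. \<forall>z\<in>E. y \<in> elts z \<longrightarrow> g y \<in> elts (g z))
      \<and> (\<forall>b\<in>elts a. E \<inter> elts b \<in> S b)" for a E g
    have "\<forall>a\<in>elts l. \<exists>E g. P a E g" using E unfolding l_def P_def by blast
    then obtain E g where "\<forall>a\<in>elts l. P a (E a) (g a)" by metis
    then show thesis using that[of E g] unfolding P_def image_subset_iff by blast
  qed
  have "\<exists>F. F \<subseteq> elts a \<and> (\<forall>x\<in>elts a. \<exists>y\<in>F. elts x \<subseteq> elts y) \<and> (\<forall>x\<in>elts a. F \<inter> elts x \<prec> elts k)"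
    if a: "a \<in> elts l" for a
  proof -
    obtain F where F: "F \<subseteq> elts a" "\<And>x. x \<in> elts a \<Longrightarrow> \<exists>y\<in>F. elts x \<subseteq> elts y"
        "\<And>x. x \<in> elts a \<Longrightarrow> \<exists>i\<in>elts k. F \<inter> elts x \<lesssim> elts i"
      using short_cofinal_subset[OF ok] a l by metis
    have "F \<inter> elts x \<prec> elts k" if x: "x \<in> elts a" for x
    proof -
      obtain i where i: "i \<in> elts k" "F \<inter> elts x \<lesssim> elts i" using F(3)[OF x] by blast
      then have "elts i \<prec> elts k" using cardinal_lepoll_iff[OF k(1)] ordinal_mem[OF ok] by blast
      then show ?thesis using i(2) lesspoll_trans1 by blast
    qed
    then show ?thesis using F by blast
  qed
  then obtain F where F: "\<And>a. a \<in> elts l \<Longrightarrow> F a \<subseteq> elts a"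
      "\<And>a x. a \<in> elts l \<Longrightarrow> x \<in> elts a \<Longrightarrow> \<exists>y\<in>F a. elts x \<subseteq> elts y"
      "\<And>a x. a \<in> elts l \<Longrightarrow> x \<in> elts a \<Longrightarrow> F a \<inter> elts x \<prec> elts k"
    by metis
  define e where "e a = otp (E a) a" for a
  \<comment> \<open>The thinning set is indexed by the order type \<open>e a\<close> and not by
    \<open>a\<close>; as \<open>e a\<close> is at most \<open>d\<close>, there are at most
    \<open>k\<close> many thinning sets in all.\<close>
  define X where "X a = thin (E a) (F (e a))" for a
  have ordE: "is_ordinal x" if "a \<in> elts l" "x \<in> E a" for a x
    using that E(1) ord ordinal_mem by blast
  have e_le: "elts (e a) \<subseteq> elts d" if a: "a \<in> elts l" for a
  proof
    fix z assume "z \<in> elts (e a)"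
    then obtain x where x: "x \<in> E a" "z = otp (E a) x" unfolding e_def by (auto simp: elts_otp)
    have gx: "g a x \<in> elts d" using g(1)[OF a x(1)] .
    have "elts z \<subseteq> elts (g a x)"
      unfolding x(2)
    proof (rule otp_least)
      show "is_ordinal (g a y)" if "y \<in> E a" for y using g(1)[OF a that] ordinal_mem[OF d(1)] by blast
    qed (use g(2)[OF a] x(1) ordE[OF a] in blast)+
    moreover have oz: "is_ordinal z" using otp_ordinal ordE[OF a x(1)] x(2) by blast
    ultimately have "z = g a x \<or> z \<in> elts (g a x)"
      using ordinal_linear[OF oz ordinal_mem[OF d(1) gx]] not_mem_self by blast
    then show "z \<in> elts d" using gx ordinal_trans[OF d(1)] by blast
  qed
  have e_mem: "e a \<in> elts (ord_succ d)" and e_l: "e a \<in> elts l" if a: "a \<in> elts l" for a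
  proof -
    have oe: "is_ordinal (e a)" unfolding e_def by (rule otp_ordinal[OF ord[OF a]])
    show "e a \<in> elts (ord_succ d)"
      using ordinal_linear[OF oe d(1)] e_le[OF a] not_mem_self by (auto simp: elts_ord_succ)
    show "e a \<in> elts l" using l oe e_le[OF a] d(2) lepoll_trans[OF subset_imp_lepoll] by blast
  qed
  have X_sub: "X a \<subseteq> elts a" if "a \<in> elts l" for a
    using E(1)[OF that] thin_subset unfolding X_def by blast
  have X_cof: "\<exists>y\<in>X a. elts x \<subseteq> elts y" if a: "a \<in> elts l" "x \<in> elts a" for a x
    unfolding X_def
    by (rule thin_cofinal[OF ord[OF a(1)] E(1,2)[OF a(1)]])
       (use F(1,2)[OF e_l[OF a(1)]] a(2) in \<open>auto simp flip: e_def\<close>)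
  have X_small: "X a \<inter> elts x \<prec> elts k" if a: "a \<in> elts l" "x \<in> X a" for a x
  proof -
    have "x \<in> E a" using a(2) thin_subset unfolding X_def by blast
    then have "otp (E a) x \<in> elts (e a)" using E(1)[OF a(1)] otp_mono unfolding e_def by blast
    then have "F (e a) \<inter> elts (otp (E a) x) \<prec> elts k" using F(3)[OF e_l[OF a(1)]] by blast
    moreover have "X a \<inter> elts x \<lesssim> F (e a) \<inter> elts (otp (E a) x)"
      unfolding X_def by (rule thin_initial_lepoll) (use ordE[OF a(1)] in blast)
    ultimately show ?thesis using lesspoll_trans1 by blast
  qed
  \<comment> \<open>Coherence demands the closures at \<open>b\<close> coming from all larger
    \<open>a\<close> of which \<open>b\<close> is a limit point; the limit condition makes them
    unbounded in \<open>b\<close>. Each is determined by a member of \<open>S b\<close> and an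
    ordinal up to \<open>d\<close>, so only \<open>k\<close> many arise.\<close>
  define C where "C b = {clo (X a) b | a. a \<in> elts l \<and> (a = b \<or> b \<in> elts a \<and> limit_point (X a) b)}" for b
  have C_size: "C b \<lesssim> elts k" if b: "b \<in> elts l" for b
  proof -
    let ?f = "\<lambda>(D, i). clo (thin D (F i)) b"
    have "C b \<subseteq> insert (clo (X b) b) (?f ` (S b \<times> elts (ord_succ d)))"
    proof
      fix D assume "D \<in> C b"
      then obtain a where a: "a \<in> elts l" "D = clo (X a) b" "a = b \<or> b \<in> elts a"
        unfolding C_def by blast
      show "D \<in> insert (clo (X b) b) (?f ` (S b \<times> elts (ord_succ d)))"
      proof (cases "a = b")
        case False
        then have ba: "b \<in> elts a" using a(3) by blast
        have "D = clo (X a \<inter> elts b) b" using clo_Int_left[OF ord[OF b]] a(2) by blast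
        then have "D = ?f (E a \<inter> elts b, e a)"
          unfolding X_def thin_Int[OF ord[OF b]] by simp
        moreover have "(E a \<inter> elts b, e a) \<in> S b \<times> elts (ord_succ d)"
          using E(3)[OF a(1) ba] e_mem[OF a(1)] by blast
        ultimately show ?thesis by blast
      qed (use a in blast)
    qed
    moreover have "insert (clo (X b) b) (?f ` (S b \<times> elts (ord_succ d))) \<lesssim> elts k"
    proof -
      have "elts (ord_succ d) \<lesssim> elts k"
        unfolding elts_ord_succ by (rule insert_lepoll_infinite[OF k(2) d(2)])
      then have "S b \<times> elts (ord_succ d) \<lesssim> elts k"
        using Times_lepoll[OF k(2)] S b l_def by blast
      then have "?f ` (S b \<times> elts (ord_succ d)) \<lesssim> elts k" by (rule lepoll_trans[OF image_lepoll])
      then show ?thesis by (rule insert_lepoll_infinite[OF k(2)])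
    qed
    ultimately show ?thesis by (rule lepoll_trans[OF subset_imp_lepoll])
  qed
  have C_club: "club_in D b \<and> (\<exists>i\<in>elts (ord_succ k). has_order_type D i)"
    if b: "b \<in> elts l" and D: "D \<in> C b" for b D
  proof -
    obtain a where a: "a \<in> elts l" "D = clo (X a) b" "a = b \<or> b \<in> elts a \<and> limit_point (X a) b"
      using D unfolding C_def by blast
    have ob: "is_ordinal b" and oa: "is_ordinal a" using ord a b by blast+
    have "\<exists>z\<in>D. y = z \<or> y \<in> elts z" if y: "y \<in> elts b" for y
      using a(3)
    proof
      assume ab: "a = b"
      then obtain z where z: "z \<in> X a" "elts y \<subseteq> elts z" using X_cof[OF a(1)] y by blast
      then have zb: "z \<in> elts b" using X_sub[OF a(1)] ab by blast
      then have "y = z \<or> y \<in> elts z"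
        using ordinal_linear[of y z] ordinal_mem[OF ob] y z(2) not_mem_self by blast
      then show ?thesis using z zb a(2) unfolding clo_def by blast
    next
      assume "b \<in> elts a \<and> limit_point (X a) b"
      then obtain z where "z \<in> X a" "y \<in> elts z" "z \<in> elts b"
        using y unfolding limit_point_def by blast
      then show ?thesis using a(2) unfolding clo_def by blast
    qed
    moreover have "y \<in> D" if y: "y \<in> elts b" "limit_point D y" for y
      using limit_point_clo[OF ob ordinal_mem[OF ob y(1)]] y a(2) unfolding clo_def by blast
    moreover have D_sub: "D \<subseteq> elts b" using a(2) unfolding clo_def by blast
    ultimately have "club_in D b" unfolding club_in_def by blast
    moreover have "D \<inter> elts x \<prec> elts k" if x: "x \<in> D" for x
    proof -
      have ba: "elts b \<subseteq> elts a" using a(3) ordinal_subset[OF oa] by blast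
      then have "clo (X a) a \<inter> elts x \<prec> elts k"
        using clo_initial_lesspoll[OF oa X_sub[OF a(1)] X_cof[OF a(1)] X_small[OF a(1)] k(2), of x] x D_sub
        by blast
      moreover have "D \<inter> elts x \<subseteq> clo (X a) a \<inter> elts x" using ba a(2) unfolding clo_def by blast
      ultimately show ?thesis using lesspoll_trans1[OF subset_imp_lepoll] by blast
    qed
    then have "\<exists>i\<in>elts (ord_succ k). has_order_type D i"
      by (rule otp_le_cardinal[OF k(1) ob D_sub])
    ultimately show ?thesis by blast
  qed
  have C_coh: "D \<inter> elts y \<in> C y"
    if b: "b \<in> elts l" and D: "D \<in> C b" and y: "y \<in> elts b" "limit_point D y" for b D y
  proof -
    obtain a where a: "a \<in> elts l" "D = clo (X a) b" "a = b \<or> b \<in> elts a"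
      using D unfolding C_def by blast
    have "limit_point (X a) y"
      using limit_point_clo[OF ord[OF b] ordinal_mem[OF ord[OF b] y(1)]] y(2) a(2) by blast
    moreover have "y \<in> elts a" using a(3) y(1) ordinal_trans[OF ord[OF a(1)]] by blast
    moreover have "D \<inter> elts y = clo (X a) y" using clo_Int[OF ord[OF b] y(1)] a(2) by blast
    ultimately show ?thesis using a(1) unfolding C_def by blast
  qed
  have "C b \<noteq> {}" if "b \<in> elts l" for b using that unfolding C_def by blast
  then show ?thesis
    unfolding weak_square_def l_def[symmetric]
    using C_size C_club C_coh by (intro exI[of _ C] conjI ballI impI) blast+
qed

section \<open>Codes for the bounded subsets of the second successor\<close>

locale square_coding =
  fixes k l m :: "'v::set_universe"
    and t :: "'v \<Rightarrow> 'v set" and e :: "'v \<Rightarrow> 'v \<Rightarrow> 'v" and F :: "'v \<Rightarrow> 'v set"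
  assumes k: "is_cardinal k" "infinite (elts k)"
    and l: "l = card_succ k" "is_cardinal l" "elts l = {a. is_ordinal a \<and> elts a \<lesssim> elts k}"
    and m: "m = card_succ l" "is_cardinal m" "elts m = {a. is_ordinal a \<and> elts a \<lesssim> elts l}"
    and t: "\<And>X. X \<subseteq> elts l \<Longrightarrow> X \<lesssim> elts k \<Longrightarrow> X \<in> t ` elts l"
    and e: "\<And>a. a \<in> elts m \<Longrightarrow> inj_on (e a) (elts a)"
      "\<And>a x. a \<in> elts m \<Longrightarrow> x \<in> elts a \<Longrightarrow> e a x \<in> elts l"
    and F: "\<And>a. a \<in> elts m \<Longrightarrow> F a \<subseteq> elts a"
      "\<And>a x. a \<in> elts m \<Longrightarrow> x \<in> elts a \<Longrightarrow> \<exists>y\<in>F a. elts x \<subseteq> elts y"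
      "\<And>a x. a \<in> elts m \<Longrightarrow> x \<in> elts a \<Longrightarrow> F a \<inter> elts x \<lesssim> elts k"
begin

lemma ordinal_l: "is_ordinal l" and ordinal_m: "is_ordinal m"
  using l(2) m(2) by (simp_all add: is_cardinal_def)

lemma l_subset_m: "elts l \<subseteq> elts m"
proof
  fix x assume x: "x \<in> elts l"
  then have "elts x \<lesssim> elts l" using ordinal_subset[OF ordinal_l] subset_imp_lepoll by blast
  then show "x \<in> elts m" using x l(3) m(3) by blast
qed

lemma otp_F_mem:
  assumes a: "a \<in> elts m" and x: "x \<in> elts a"
  shows "otp (F a) x \<in> elts l"
proof -
  have oa: "is_ordinal a" using a m(3) by blast
  have "elts (otp (F a) x) \<approx> F a \<inter> elts x"
    by (rule otp_eqpoll) (use F(1)[OF a] ordinal_mem[OF oa] in blast)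
  then show ?thesis
    using F(3)[OF a x] lepoll_trans1 l(3) otp_ordinal[OF ordinal_mem[OF oa x]] by blast
qed

text \<open>For injective \<open>h\<close>, one index below \<open>l\<close> together with
  \<open>h\<close> recovers the initial segment of \<open>F a\<close>. In both cases of the theorem
  the approximations come from restricting such indices to a set of size at most
  \<open>k\<close>.\<close>

lemma F_coded:
  assumes a: "a \<in> elts m" and b: "b \<in> elts a" and h: "h ` elts b \<subseteq> elts l"
  shows "\<exists>i\<in>elts l. t i = h ` (F a \<inter> elts b)"
proof -
  have "h ` (F a \<inter> elts b) \<lesssim> elts k" using F(3)[OF a b] lepoll_trans[OF image_lepoll] by blast
  moreover have "h ` (F a \<inter> elts b) \<subseteq> elts l" using h by blast
  ultimately have "h ` (F a \<inter> elts b) \<in> t ` elts l" using t by blast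
  then show ?thesis by fastforce
qed

end

lemma square_coding_exists:
  fixes k :: "'v::set_universe"
  assumes k: "is_cardinal k" "infinite (elts k)"
    and l: "l = card_succ k" "is_cardinal l" "elts l = {a. is_ordinal a \<and> elts a \<lesssim> elts k}"
    and m: "m = card_succ l" "is_cardinal m" "elts m = {a. is_ordinal a \<and> elts a \<lesssim> elts l}"
    and pow: "Pow (elts k) \<lesssim> elts l"
  obtains t e F where "square_coding k l m t e F"
proof -
  have ok: "is_ordinal k" and ol: "is_ordinal l" using k(1) l(2) is_cardinal_def by blast+
  obtain t where "{X. X \<subseteq> elts l \<and> X \<lesssim> elts k} \<subseteq> t ` elts l"
    using card_bounded_subsets[OF k(2) ok l(3) pow] unfolding lepoll_iff by blast
  then have t: "X \<in> t ` elts l" if "X \<subseteq> elts l" "X \<lesssim> elts k" for X using that by blast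
  have "\<exists>e. inj_on e (elts a) \<and> e ` elts a \<subseteq> elts l" if "a \<in> elts m" for a
    using that m(3) unfolding lepoll_def by blast
  then obtain e where e: "\<And>a. a \<in> elts m \<Longrightarrow> inj_on (e a) (elts a)"
      "\<And>a x. a \<in> elts m \<Longrightarrow> x \<in> elts a \<Longrightarrow> e a x \<in> elts l"
    unfolding image_subset_iff by metis
  have "\<exists>F. F \<subseteq> elts a \<and> (\<forall>x\<in>elts a. \<exists>y\<in>F. elts x \<subseteq> elts y) \<and> (\<forall>x\<in>elts a. F \<inter> elts x \<lesssim> elts k)"
    if "a \<in> elts m" for a
  proof -
    have a: "is_ordinal a" "elts a \<lesssim> elts l" using that m(3) by blast+
    obtain F where F: "F \<subseteq> elts a" "\<And>x. x \<in> elts a \<Longrightarrow> \<exists>y\<in>F. elts x \<subseteq> elts y"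
        "\<And>x. x \<in> elts a \<Longrightarrow> \<exists>i\<in>elts l. F \<inter> elts x \<lesssim> elts i"
      using short_cofinal_subset[OF ol a] by metis
    have "F \<inter> elts x \<lesssim> elts k" if x: "x \<in> elts a" for x
    proof -
      obtain i where "i \<in> elts l" "F \<inter> elts x \<lesssim> elts i" using F(3)[OF x] by blast
      moreover from this have "elts i \<lesssim> elts k" using l(3) by blast
      ultimately show ?thesis using lepoll_trans by blast
    qed
    then show ?thesis using F by blast
  qed
  then obtain F where F: "\<And>a. a \<in> elts m \<Longrightarrow> F a \<subseteq> elts a"
    "\<And>a x. a \<in> elts m \<Longrightarrow> x \<in> elts a \<Longrightarrow> \<exists>y\<in>F a. elts x \<subseteq> elts y"
    "\<And>a x. a \<in> elts m \<Longrightarrow> x \<in> elts a \<Longrightarrow> F a \<inter> elts x \<lesssim> elts k"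
    by metis
  have "square_coding k l m t e F"
    by (rule square_coding.intro[OF k l m t e F])
  then show thesis by (rule that)
qed

section \<open>Chang's Conjecture\<close>

text \<open>The \<open>f i\<close> become the binary function symbols of a structure without
  relations; the universe of a substructure is closed under them.\<close>

lemma chang_closed_subset:
  fixes f :: "nat \<Rightarrow> 'v::set_universe \<Rightarrow> 'v \<Rightarrow> 'v"
  assumes chang: "chang k1 k0 m1 m0" and ne: "elts k1 \<noteq> {}"
    and f: "\<And>i x y. x \<in> elts k1 \<Longrightarrow> y \<in> elts k1 \<Longrightarrow> f i x y \<in> elts k1"
  shows "\<exists>B. B \<subseteq> elts k1 \<and> B \<approx> elts m1 \<and> B \<inter> elts k0 \<approx> elts m0
    \<and> (\<forall>i. \<forall>x\<in>B. \<forall>y\<in>B. f i x y \<in> B)"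
proof -
  define A :: "'v fo_structure" where
    "A = \<lparr>univ = elts k1, fun_symbols = UNIV, fun_arity = \<lambda>_. 2,
      fun_interp = \<lambda>i xs. f i (xs ! 0) (xs ! 1), rel_symbols = {}, rel_arity = \<lambda>_. 0,
      rel_interp = \<lambda>_. {}\<rparr>"
  have "is_structure A"
    using ne f by (auto simp: is_structure_def A_def tuples_def subset_iff)
  then obtain B where B: "substructure B A" "univ B \<approx> elts m1" "univ B \<inter> elts k0 \<approx> elts m0"
    using chang unfolding chang_def A_def by (auto dest: spec)
  have "f i x y \<in> univ B" if "x \<in> univ B" "y \<in> univ B" for i x y
  proof -
    have xy: "[x, y] \<in> tuples (univ B) 2" using that by (simp add: tuples_def)
    moreover have "is_structure B" "fun_symbols B = UNIV" "fun_arity B i = 2"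
      and interp: "\<forall>xs\<in>tuples (univ B) 2. fun_interp B i xs = f i (xs ! 0) (xs ! 1)"
      using B(1) unfolding substructure_def A_def by simp_all
    ultimately have "fun_interp B i [x, y] \<in> univ B"
      unfolding is_structure_def by (metis UNIV_I)
    then show ?thesis using interp xy by simp
  qed
  moreover have "univ B \<subseteq> elts k1" using B(1) unfolding substructure_def A_def by simp
  ultimately show ?thesis using B(2,3) by (intro exI[of _ "univ B"]) blast
qed

lemma (in square_coding) weak_square_if_chang:
  assumes chang: "chang m l l k"
  shows "weak_square k"
proof -
  define nxt where "nxt a x = (SOME y. y \<in> F a \<and> elts x \<subseteq> elts y)" for a x
  have nxt: "nxt a x \<in> F a" "elts x \<subseteq> elts (nxt a x)" if "a \<in> elts m" "x \<in> elts a" for a x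
  proof -
    have "\<exists>y. y \<in> F a \<and> elts x \<subseteq> elts y" using F(2)[OF that] by blast
    then have "nxt a x \<in> F a \<and> elts x \<subseteq> elts (nxt a x)" unfolding nxt_def by (rule someI_ex)
    then show "nxt a x \<in> F a" "elts x \<subseteq> elts (nxt a x)" by blast+
  qed
  define ix where "ix a b = (SOME i. i \<in> elts l \<and> t i = e b ` (F a \<inter> elts b))" for a b
  have m_trans: "x \<in> elts m" if "a \<in> elts m" "x \<in> elts a" for a x
    using that ordinal_trans[OF ordinal_m] by blast
  have ix: "ix a b \<in> elts l" "t (ix a b) = e b ` (F a \<inter> elts b)" if a: "a \<in> elts m" "b \<in> elts a" for a b
  proof -
    have "\<exists>i. i \<in> elts l \<and> t i = e b ` (F a \<inter> elts b)"
      using F_coded[OF a] e(2)[OF m_trans[OF a]] by blast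
    then have "ix a b \<in> elts l \<and> t (ix a b) = e b ` (F a \<inter> elts b)" unfolding ix_def by (rule someI_ex)
    then show "ix a b \<in> elts l" "t (ix a b) = e b ` (F a \<inter> elts b)" by blast+
  qed
  \<comment> \<open>Four binary functions, selected by the residue of \<open>i\<close> modulo 4. The
    default value \<open>a\<close> makes closure trivial when \<open>x\<close> is not below
    \<open>a\<close>.\<close>
  define f where "f i a x = (if x \<in> elts a then [nxt a x, otp (F a) x, ix a x, e a x] ! (i mod 4) else a)"
    for i :: nat and a x
  have f_closed: "f i a x \<in> elts m" if a: "a \<in> elts m" "x \<in> elts m" for i a x
  proof (cases "x \<in> elts a")
    case True
    have "{nxt a x, otp (F a) x, ix a x, e a x} \<subseteq> elts m"
      using nxt(1)[OF a(1) True] F(1)[OF a(1)] m_trans[OF a(1)] l_subset_m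
        otp_F_mem[OF a(1) True] ix(1)[OF a(1) True] e(2)[OF a(1) True] by blast
    moreover have "[nxt a x, otp (F a) x, ix a x, e a x] ! (i mod 4) \<in> {nxt a x, otp (F a) x, ix a x, e a x}"
      using nth_mem[of "i mod 4" "[nxt a x, otp (F a) x, ix a x, e a x]"] by simp
    ultimately show ?thesis using True unfolding f_def by auto
  qed (use a in \<open>simp add: f_def\<close>)
  have "k \<in> elts l" using k(1) l(3) unfolding is_cardinal_def by blast
  then have k_m: "elts m \<noteq> {}" using l_subset_m by blast
  have "\<exists>B. B \<subseteq> elts m \<and> B \<approx> elts l \<and> B \<inter> elts l \<approx> elts k
    \<and> (\<forall>i. \<forall>x\<in>B. \<forall>y\<in>B. f i x y \<in> B)"
    by (rule chang_closed_subset[OF chang k_m f_closed])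
  then obtain B where B: "B \<subseteq> elts m" "B \<approx> elts l" "B \<inter> elts l \<approx> elts k"
    and closed: "\<And>i x y. x \<in> B \<Longrightarrow> y \<in> B \<Longrightarrow> f i x y \<in> B"
    by blast
  have B_nxt: "nxt a x \<in> B" and B_otp: "otp (F a) x \<in> B" and B_ix: "ix a x \<in> B" and B_e: "e a x \<in> B"
    if "a \<in> B" "x \<in> B" "x \<in> elts a" for a x
  proof -
    have "[nxt a x, otp (F a) x, ix a x, e a x] ! (i mod 4) \<in> B" for i :: nat
      using closed[OF that(1,2), of i] that(3) unfolding f_def by simp
    from this[of 0] this[of 1] this[of 2] this[of 3]
    show "nxt a x \<in> B" "otp (F a) x \<in> B" "ix a x \<in> B" "e a x \<in> B" by simp_all
  qed
  have ordB: "is_ordinal x" if "x \<in> B" for x using that B(1) m(3) by blast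
  define p where "p = otp B"
  have p_ord: "is_ordinal (p x)" if "x \<in> B" for x using otp_ordinal ordB that p_def by blast
  have p_iff: "p x \<in> elts (p y) \<longleftrightarrow> x \<in> elts y" if "x \<in> B" "y \<in> B" for x y
    unfolding p_def using otp_mem_iff that ordB by blast
  have p_inj: "inj_on p B" unfolding p_def by (rule otp_inj_on) (rule ordB)
  have elts_p: "elts (p x) = p ` (B \<inter> elts x)" for x unfolding p_def by (rule elts_otp)
  \<comment> \<open>\<open>B\<close> is closed under \<open>e\<close>, so \<open>e a\<close> injects
    the part of \<open>B\<close> below \<open>a\<close> into the part of \<open>B\<close> below
    \<open>l\<close>, which has size \<open>k\<close>.\<close>
  have p_l: "p a \<in> elts l" if a: "a \<in> B" for a
  proof -
    have am: "a \<in> elts m" using a B(1) by blast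
    have "e a ` (B \<inter> elts a) \<subseteq> B \<inter> elts l" using B_e[OF a] e(2)[OF am] by blast
    moreover have "inj_on (e a) (B \<inter> elts a)" using e(1)[OF am] by (rule inj_on_subset) blast
    ultimately have "B \<inter> elts a \<lesssim> B \<inter> elts l" unfolding lepoll_def by blast
    then have "B \<inter> elts a \<lesssim> elts k" using B(3) by (rule lepoll_trans2)
    then have "elts (p a) \<lesssim> elts k"
      using otp_eqpoll[of B a] ordB lepoll_trans1 unfolding p_def by blast
    then show ?thesis using p_ord[OF a] l(3) by blast
  qed
  \<comment> \<open>The order type \<open>p m\<close> of \<open>B\<close> has size \<open>l\<close>
    while all its members lie below \<open>l\<close>; so it is \<open>l\<close>.\<close>
  have p_image: "p ` B = elts l"
  proof -
    have el: "elts (p m) = p ` B" using elts_p[of m] B(1) by (simp add: Int_absorb2)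
    have "elts (p m) \<approx> elts l"
      unfolding el using inj_on_image_eqpoll_self[OF p_inj] B(2) by (rule eqpoll_trans)
    then have "p m \<notin> elts l" using l(2) unfolding is_cardinal_def by metis
    moreover have "l \<notin> elts (p m)" unfolding el using p_l not_mem_self[of l] by auto
    moreover have "is_ordinal (p m)" unfolding p_def by (rule otp_ordinal[OF ordinal_m])
    ultimately have "p m = l" using ordinal_linear ordinal_l by blast
    then show ?thesis using el by simp
  qed
  define q where "q = inv_into B p"
  have q: "q a \<in> B" "p (q a) = a" if "a \<in> elts l" for a
    using that p_image inv_into_into[of a p B] f_inv_into_f[of a p B] unfolding q_def by simp_all
  have qp: "q (p x) = x" if "x \<in> B" for x unfolding q_def using inv_into_f_f[OF p_inj that] .
  \<comment> \<open>The positions \<open>otp (F b) x\<close> with \<open>b\<close> and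
    \<open>x\<close> in \<open>B\<close> lie in \<open>B\<close> and below \<open>l\<close>;
    collapsing this set of size \<open>k\<close> gives a common bound below \<open>l\<close> on the
    order types.\<close>
  define d where "d = otp (B \<inter> elts l) l"
  have "elts d \<approx> B \<inter> elts l \<inter> elts l"
    unfolding d_def by (rule otp_eqpoll) (use ordB in blast)
  then have "elts d \<lesssim> elts k" using B(3) by (simp add: Int_assoc eqpoll_imp_lepoll eqpoll_trans)
  then have d: "d \<in> elts l" using l(3) otp_ordinal[OF ordinal_l] unfolding d_def by blast
  \<comment> \<open>All subsets at level \<open>a\<close> that indices in \<open>B\<close> can name
    through the injection \<open>e (q a)\<close>; \<open>q a\<close> is the member of
    \<open>B\<close> that collapses to \<open>a\<close>.\<close>
  define S where "S a = (\<lambda>i. p ` {x \<in> B \<inter> elts (q a). e (q a) x \<in> t i}) ` (B \<inter> elts l)" for a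
  show ?thesis
  proof (rule weak_square_if_approximations[OF k l(3)[unfolded l(1)] d[unfolded l(1)], of S, folded l(1)])
    fix a assume "a \<in> elts l"
    show "S a \<lesssim> elts k" unfolding S_def by (rule lepoll_trans2[OF image_lepoll B(3)])
  next
    fix a assume "a \<in> elts l"
    define b where "b = q a"
    have b: "b \<in> B" "p b = a" using q[OF \<open>a \<in> elts l\<close>] unfolding b_def by blast+
    have bm: "b \<in> elts m" using b(1) B(1) by blast
    \<comment> \<open>The collapse of the part of \<open>F b\<close> in \<open>B\<close>, mapped by
      \<open>?g\<close> to positions in \<open>F b\<close>, collapsed in turn.\<close>
    let ?E = "p ` (F b \<inter> B)" and ?g = "\<lambda>y. otp (B \<inter> elts l) (otp (F b) (q y))"
    have 1: "?E \<subseteq> elts a" using b p_iff F(1)[OF bm] by blast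
    have 2: "\<exists>y\<in>?E. elts x \<subseteq> elts y" if "x \<in> elts a" for x
    proof -
      have "x \<in> elts (p b)" using that b(2) by simp
      then obtain y where y: "y \<in> B" "y \<in> elts b" "x = p y" using elts_p by blast
      have "nxt b y \<in> F b \<inter> B" using nxt(1)[OF bm y(2)] B_nxt[OF b(1) y(1,2)] by blast
      moreover have "elts (p y) \<subseteq> elts (p (nxt b y))"
        using nxt(2)[OF bm y(2)] unfolding elts_p by blast
      ultimately show ?thesis using y(3) by blast
    qed
    have 3: "?g ` ?E \<subseteq> elts d"
    proof
      fix z assume "z \<in> ?g ` ?E"
      then obtain x where x: "x \<in> F b" "x \<in> B" "z = otp (B \<inter> elts l) (otp (F b) x)"
        using qp by auto
      have xb: "x \<in> elts b" using x(1) F(1)[OF bm] by blast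
      have "otp (F b) x \<in> B \<inter> elts l" using B_otp[OF b(1) x(2) xb] otp_F_mem[OF bm xb] by blast
      then show "z \<in> elts d" unfolding x(3) d_def using otp_mono by blast
    qed
    have 4: "?g y \<in> elts (?g z)" if yz: "y \<in> ?E" "z \<in> ?E" "y \<in> elts z" for y z
    proof -
      obtain x w where x: "x \<in> F b" "x \<in> B" "y = p x" and w: "w \<in> F b" "w \<in> B" "z = p w"
        using yz by blast
      have "x \<in> elts w" using yz(3) p_iff x w by blast
      then have "otp (F b) x \<in> elts (otp (F b) w)" using x(1) otp_mono by blast
      moreover have xb: "x \<in> elts b" using x(1) F(1)[OF bm] by blast
      have "otp (F b) x \<in> B \<inter> elts l" using B_otp[OF b(1) x(2) xb] otp_F_mem[OF bm xb] by blast
      ultimately show ?thesis unfolding x(3) w(3) qp[OF x(2)] qp[OF w(2)] using otp_mono by blast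
    qed
    have 5: "?E \<inter> elts y \<in> S y" if y: "y \<in> elts a" for y
    proof -
      have "y \<in> elts (p b)" using y b(2) by simp
      then obtain c where c: "c \<in> B" "c \<in> elts b" "y = p c" using elts_p by blast
      have cm: "c \<in> elts m" using m_trans[OF bm c(2)] .
      have "?E \<inter> elts y = p ` (F b \<inter> elts c \<inter> B)"
        unfolding c(3) using p_iff[OF _ c(1)] by blast
      \<comment> \<open>Injectivity of \<open>e c\<close> turns membership in \<open>F b\<close>
        below \<open>c\<close> into membership of the image in \<open>t (ix b c)\<close>, and the
        index is in \<open>B\<close> by closure.\<close>
      also have "F b \<inter> elts c \<inter> B = {x \<in> B \<inter> elts c. e c x \<in> t (ix b c)}"
        unfolding ix(2)[OF bm c(2)] using inj_on_image_mem_iff[OF e(1)[OF cm], of _ "F b \<inter> elts c"] by blast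
      also have "p ` \<dots> \<in> S y"
        unfolding S_def c(3) qp[OF c(1)] using B_ix[OF b(1) c(1,2)] ix(1)[OF bm c(2)] by blast
      finally show ?thesis .
    qed
    show "\<exists>E g. E \<subseteq> elts a \<and> (\<forall>x\<in>elts a. \<exists>y\<in>E. elts x \<subseteq> elts y)
      \<and> g ` E \<subseteq> elts d \<and> (\<forall>y\<in>E. \<forall>z\<in>E. y \<in> elts z \<longrightarrow> g y \<in> elts (g z))
      \<and> (\<forall>b\<in>elts a. E \<inter> elts b \<in> S b)"
      by (rule exI[of _ ?E], rule exI[of _ ?g]) (intro conjI ballI impI 1 2 3 4 5)
  qed
qed

section \<open>Normal ideals\<close>

locale normal_ideal =
  fixes l :: "'v::set_universe" and I :: "'v set set"
  assumes ordinal: "is_ordinal l" and normal: "normal_ideal_on (elts l) (elts l) I"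
begin

text \<open>With this filter "eventually" means off a set in \<open>I\<close> and "frequently" means
  on an \<open>I\<close>-positive set, so forcing arguments become filter arguments.\<close>

definition dual_filter :: "'v filter" where
  "dual_filter = Abs_filter (\<lambda>P. {z \<in> elts l. \<not> P z} \<in> I)"

lemma ideal: "ideal_on (elts l) I"
  using normal unfolding normal_ideal_on_def by blast

lemma ideal_subset: "A \<in> I \<Longrightarrow> B \<subseteq> A \<Longrightarrow> B \<in> I"
  using ideal unfolding ideal_on_def by blast

lemma ideal_Un: "A \<in> I \<Longrightarrow> B \<in> I \<Longrightarrow> A \<union> B \<in> I"
  using ideal unfolding ideal_on_def by blast

text \<open>Some member of \<open>I\<close> is given by normality: through the sets of
  \<open>z\<close> omitting a point if \<open>l\<close> is nonempty, and through a diagonal union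
  over no indices otherwise.\<close>

lemma empty_ideal: "{} \<in> I"
proof -
  have "I \<noteq> {}"
  proof (cases "elts l = {}")
    case False
    then show ?thesis using normal unfolding normal_ideal_on_def by blast
  next
    case True
    have "\<forall>A. (\<forall>x\<in>elts l. A x \<in> I) \<longrightarrow> {z \<in> elts l. \<exists>x\<in>elts z. z \<in> A x} \<in> I"
      using normal unfolding normal_ideal_on_def by blast
    then show ?thesis using True by auto
  qed
  then show ?thesis using ideal_subset by blast
qed

lemma eventually_dual: "eventually P dual_filter \<longleftrightarrow> {z \<in> elts l. \<not> P z} \<in> I"
  unfolding dual_filter_def
proof (rule eventually_Abs_filter, rule is_filter.intro)
  show "{z \<in> elts l. \<not> True} \<in> I" using empty_ideal by simp
next
  fix P Q :: "'v \<Rightarrow> bool"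
  assume PQ: "{z \<in> elts l. \<not> P z} \<in> I" "{z \<in> elts l. \<not> Q z} \<in> I"
  have "{z \<in> elts l. \<not> (P z \<and> Q z)} = {z \<in> elts l. \<not> P z} \<union> {z \<in> elts l. \<not> Q z}" by blast
  then show "{z \<in> elts l. \<not> (P z \<and> Q z)} \<in> I" using ideal_Un PQ by simp
next
  fix P Q :: "'v \<Rightarrow> bool"
  assume PQ: "\<forall>z. P z \<longrightarrow> Q z" "{z \<in> elts l. \<not> P z} \<in> I"
  show "{z \<in> elts l. \<not> Q z} \<in> I" by (rule ideal_subset[OF PQ(2)]) (use PQ(1) in blast)
qed

lemma frequently_dual: "frequently P dual_filter \<longleftrightarrow> {z \<in> elts l. P z} \<notin> I"
  unfolding frequently_def eventually_dual by simp

lemma eventually_in: "\<forall>\<^sub>F z in dual_filter. z \<in> elts l"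
  unfolding eventually_dual using empty_ideal by simp

lemma eventually_mem: "x \<in> elts l \<Longrightarrow> \<forall>\<^sub>F z in dual_filter. x \<in> elts z"
  unfolding eventually_dual using normal unfolding normal_ideal_on_def by blast

lemma eventually_diagonal:
  assumes "\<And>x. x \<in> elts l \<Longrightarrow> \<forall>\<^sub>F z in dual_filter. A x z"
  shows "\<forall>\<^sub>F z in dual_filter. \<forall>x\<in>elts z. A x z"
proof -
  have "\<forall>x\<in>elts l. {z \<in> elts l. \<not> A x z} \<in> I"
    using assms unfolding eventually_dual by blast
  moreover have "(\<forall>x\<in>elts l. B x \<in> I) \<longrightarrow> {z \<in> elts l. \<exists>x\<in>elts z. z \<in> B x} \<in> I" for B
    using normal unfolding normal_ideal_on_def by blast
  from this[of "\<lambda>x. {z \<in> elts l. \<not> A x z}"]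
  have "{z \<in> elts l. \<exists>x\<in>elts z. z \<in> {z \<in> elts l. \<not> A x z}} \<in> I" using calculation by blast
  moreover have "{z \<in> elts l. \<exists>x\<in>elts z. z \<in> {z \<in> elts l. \<not> A x z}} = {z \<in> elts l. \<not> (\<forall>x\<in>elts z. A x z)}"
    by blast
  ultimately show ?thesis unfolding eventually_dual by simp
qed

text \<open>Fodor's lemma, as the contrapositive of closure under diagonal intersections.\<close>

lemma pressing_down:
  assumes "\<exists>\<^sub>F z in dual_filter. P z \<and> h z \<in> elts z"
  shows "\<exists>x\<in>elts l. \<exists>\<^sub>F z in dual_filter. P z \<and> h z = x"
proof (rule ccontr)
  assume neg: "\<not> ?thesis"
  have "\<forall>\<^sub>F z in dual_filter. \<forall>x\<in>elts z. \<not> (P z \<and> h z = x)"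
    by (rule eventually_diagonal) (use neg in \<open>auto simp: frequently_def\<close>)
  then have "\<forall>\<^sub>F z in dual_filter. \<not> (P z \<and> h z \<in> elts z)"
    by (rule eventually_mono) blast
  then show False using assms unfolding frequently_def by blast
qed

text \<open>The set of those \<^term>\<open>x \<in> elts b\<close> with \<^term>\<open>e x \<in> elts z\<close> plays the role of the intersection of
  \<^term>\<open>elts b\<close> with an elementary substructure whose trace on \<^term>\<open>l\<close> is \<^term>\<open>z\<close>.\<close>

lemma eventually_hull:
  assumes e: "inj_on e (elts b)" "e ` elts b \<subseteq> elts l"
    and A: "\<And>x. x \<in> elts b \<Longrightarrow> \<forall>\<^sub>F z in dual_filter. A x z"
  shows "\<forall>\<^sub>F z in dual_filter. \<forall>x\<in>elts b. e x \<in> elts z \<longrightarrow> A x z"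
proof -
  have "\<forall>\<^sub>F z in dual_filter. \<forall>x\<in>elts b. e x = u \<longrightarrow> A x z" if "u \<in> elts l" for u
  proof (cases "u \<in> e ` elts b")
    case True
    then obtain x where x: "x \<in> elts b" "u = e x" by blast
    have "\<forall>\<^sub>F z in dual_filter. A x z" using A x by blast
    then show ?thesis by (rule eventually_mono) (use x e(1) in \<open>auto dest: inj_onD\<close>)
  next
    case False
    then show ?thesis by (intro always_eventually) blast
  qed
  then have "\<forall>\<^sub>F z in dual_filter. \<forall>u\<in>elts z. \<forall>x\<in>elts b. e x = u \<longrightarrow> A x z"
    by (rule eventually_diagonal)
  then show ?thesis by (rule eventually_mono) blast
qed

text \<open>Fodor's lemma transported along \<open>e\<close>: the map \<open>e (c z)\<close> is
  regressive, and injectivity of \<open>e\<close> turns its constant value back into a member of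
  \<open>b\<close>.\<close>

lemma pressing_down_hull:
  assumes e: "inj_on e (elts b)" "e ` elts b \<subseteq> elts l"
    and fr: "\<exists>\<^sub>F z in dual_filter. P z \<and> c z \<in> elts b \<and> e (c z) \<in> elts z"
  shows "\<exists>x\<in>elts b. e x \<in> elts l \<and> (\<exists>\<^sub>F z in dual_filter. P z \<and> c z = x)"
proof -
  have "\<exists>\<^sub>F z in dual_filter. (P z \<and> c z \<in> elts b) \<and> e (c z) \<in> elts z"
    using fr by (rule frequently_elim1) blast
  then obtain u where u: "u \<in> elts l" "\<exists>\<^sub>F z in dual_filter. (P z \<and> c z \<in> elts b) \<and> e (c z) = u"
    using pressing_down[of "\<lambda>z. P z \<and> c z \<in> elts b" "\<lambda>z. e (c z)"] by blast
  then obtain z0 where z0: "c z0 \<in> elts b" "e (c z0) = u"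
    using frequently_ex[OF u(2)] by blast
  have "\<exists>\<^sub>F z in dual_filter. P z \<and> c z = c z0"
    by (rule frequently_elim1[OF u(2)]) (use z0 e(1) in \<open>auto dest: inj_onD\<close>)
  then show ?thesis using z0(1) e(2) by blast
qed

end

section \<open>The canonical functions\<close>

text \<open>For an injection \<open>e\<close> of \<open>b\<close> into \<open>l\<close>, the
  canonical function of the ordinal \<open>b\<close>: the order type of the hull of \<open>b\<close>
  at \<open>z\<close>. Keeping \<open>e\<close> while \<open>b\<close> varies makes
  \<open>can e\<close> the collapsing map of the hull.\<close>

definition can :: "('v::set_universe \<Rightarrow> 'v) \<Rightarrow> 'v \<Rightarrow> 'v \<Rightarrow> 'v" where
  "can e b z = otp {x \<in> elts b. e x \<in> elts z} b"

lemma otp_eq_can: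
  assumes "is_ordinal b" "x \<in> elts b"
  shows "otp {x \<in> elts b. e x \<in> elts z} x = can e x z"
  unfolding can_def
  by (rule otp_cong[OF ordinal_mem[OF assms]]) (use ordinal_subset[OF assms] in blast)

lemma elts_can:
  assumes "is_ordinal b"
  shows "elts (can e b z) = (\<lambda>x. can e x z) ` {x \<in> elts b. e x \<in> elts z}"
proof -
  have "elts (can e b z) = otp {x \<in> elts b. e x \<in> elts z} ` {x \<in> elts b. e x \<in> elts z}"
    unfolding can_def elts_otp by (rule arg_cong[of _ _ "image _"]) blast
  also have "\<dots> = (\<lambda>x. can e x z) ` {x \<in> elts b. e x \<in> elts z}"
    by (rule image_cong) (use otp_eq_can[OF assms] in auto)
  finally show ?thesis .
qed

lemma can_mono: "is_ordinal b \<Longrightarrow> x \<in> elts b \<Longrightarrow> e x \<in> elts z \<Longrightarrow> can e x z \<in> elts (can e b z)"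
  by (auto simp: elts_can)

lemma can_ordinal: "is_ordinal b \<Longrightarrow> is_ordinal (can e b z)"
  unfolding can_def by (rule otp_ordinal)

lemma can_mem_iff:
  assumes "is_ordinal x" "is_ordinal y" "e x \<in> elts z" "e y \<in> elts z"
  shows "can e x z \<in> elts (can e y z) \<longleftrightarrow> x \<in> elts y"
  using assms can_mono can_ordinal ordinal_linear[of x y] not_mem_self
    ordinal_trans[of "can e x z" "can e y z" "can e x z"] by metis

lemma can_eq_iff:
  assumes "is_ordinal x" "is_ordinal y" "e x \<in> elts z" "e y \<in> elts z"
  shows "can e x z = can e y z \<longleftrightarrow> x = y"
  using ordinal_linear[OF assms(1,2)] can_mono assms not_mem_self by metis

lemma can_cong:
  assumes "is_ordinal b" "\<And>x. x \<in> elts b \<Longrightarrow> e x \<in> elts z \<longleftrightarrow> e' x \<in> elts z"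
  shows "can e b z = can e' b z"
  unfolding can_def by (rule otp_cong[OF assms(1)]) (use assms(2) in blast)

lemma iso_eq_can:
  assumes b: "is_ordinal b" and c: "is_ordinal c"
    and h: "bij_betw h {x \<in> elts b. e x \<in> elts z} (elts c)"
    and iff: "\<And>x y. x \<in> elts b \<Longrightarrow> y \<in> elts b \<Longrightarrow> e x \<in> elts z \<Longrightarrow> e y \<in> elts z \<Longrightarrow>
      x \<in> elts y \<longleftrightarrow> h x \<in> elts (h y)"
  shows "c = can e b z" and "\<And>x. x \<in> elts b \<Longrightarrow> e x \<in> elts z \<Longrightarrow> h x = can e x z"
proof -
  show hx: "h x = can e x z" if "x \<in> elts b" "e x \<in> elts z" for x
    using iso_eq_otp[OF h c, of x] iff otp_eq_can[OF b that(1)] that by auto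
  have "elts c = h ` {x \<in> elts b. e x \<in> elts z}" using h unfolding bij_betw_def by simp
  also have "\<dots> = elts (can e b z)"
    unfolding elts_can[OF b] by (rule image_cong) (use hx in auto)
  finally show "c = can e b z" by simp
qed

context normal_ideal
begin

text \<open>Each single value of either injection is eventually below \<open>z\<close>, and
  diagonalizing along the other injection makes this simultaneous. So canonical functions are
  independent of the injection modulo \<open>I\<close>.\<close>

lemma eventually_hull_cong:
  assumes e: "inj_on e (elts b)" "e ` elts b \<subseteq> elts l"
    and e': "inj_on e' (elts b)" "e' ` elts b \<subseteq> elts l"
  shows "\<forall>\<^sub>F z in dual_filter. \<forall>x\<in>elts b. e x \<in> elts z \<longleftrightarrow> e' x \<in> elts z"
proof -
  have 1: "\<forall>\<^sub>F z in dual_filter. \<forall>x\<in>elts b. e x \<in> elts z \<longrightarrow> e' x \<in> elts z"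
    by (rule eventually_hull[OF e]) (use e' eventually_mem in blast)
  have 2: "\<forall>\<^sub>F z in dual_filter. \<forall>x\<in>elts b. e' x \<in> elts z \<longrightarrow> e x \<in> elts z"
    by (rule eventually_hull[OF e']) (use e eventually_mem in blast)
  show ?thesis by (rule eventually_elim2[OF 1 2]) blast
qed

lemma can_less:
  assumes b: "b \<in> elts c" and c: "is_ordinal c"
    and e: "inj_on e (elts b)" "e ` elts b \<subseteq> elts l"
    and e': "inj_on e' (elts c)" "e' ` elts c \<subseteq> elts l"
  shows "\<forall>\<^sub>F z in dual_filter. can e b z \<in> elts (can e' c z)"
proof -
  have bc: "elts b \<subseteq> elts c" using ordinal_subset[OF c b] .
  have "\<forall>\<^sub>F z in dual_filter. \<forall>x\<in>elts b. e x \<in> elts z \<longleftrightarrow> e' x \<in> elts z"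
    by (rule eventually_hull_cong[OF e]) (use e' bc inj_on_subset in blast)+
  moreover have "\<forall>\<^sub>F z in dual_filter. e' b \<in> elts z"
    using eventually_mem e'(2) b by blast
  ultimately show ?thesis
  proof eventually_elim
    case (elim z)
    then have "can e b z = can e' b z" by (intro can_cong ordinal_mem[OF c b]) blast
    then show ?case using can_mono[OF c b] elim by simp
  qed
qed

lemma can_frequently_eq:
  assumes b: "is_ordinal b" and c: "is_ordinal c"
    and e: "inj_on e (elts b)" "e ` elts b \<subseteq> elts l"
    and e': "inj_on e' (elts c)" "e' ` elts c \<subseteq> elts l"
    and fr: "\<exists>\<^sub>F z in dual_filter. can e b z = can e' c z"
  shows "b = c"
proof (rule ccontr)
  assume "b \<noteq> c"
  then have "\<forall>\<^sub>F z in dual_filter. can e b z \<in> elts (can e' c z) \<or> can e' c z \<in> elts (can e b z)"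
    using ordinal_linear[OF b c] can_less[OF _ c e e'] can_less[OF _ b e' e]
    by (auto elim: eventually_mono)
  then have "\<forall>\<^sub>F z in dual_filter. can e b z \<noteq> can e' c z"
    by (rule eventually_mono) (metis not_mem_self)
  then show False using fr unfolding frequently_def by blast
qed

section \<open>The generic ultrapower\<close>

abbreviation conds where "conds \<equiv> conditions (elts l) I"
abbreviation coll where "coll \<equiv> ult_collapse (elts l) I"

lemma conds_iff: "p \<in> conds \<longleftrightarrow> p \<subseteq> elts l \<and> (\<exists>\<^sub>F z in dual_filter. z \<in> p)"
proof -
  have "p \<subseteq> elts l \<Longrightarrow> {z \<in> elts l. z \<in> p} = p" by blast
  then show ?thesis unfolding conditions_def frequently_dual by auto
qed

lemma conds_Collect:
  assumes "\<exists>\<^sub>F z in dual_filter. P z"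
  shows "{z \<in> elts l. P z} \<in> conds"
  unfolding conds_iff
  using frequently_eventually_conj[OF assms eventually_in] by (auto elim: frequently_elim1)

lemma below_iff:
  assumes "q \<in> conds"
  shows "below I q p \<longleftrightarrow> (\<forall>\<^sub>F z in dual_filter. z \<in> q \<longrightarrow> z \<in> p)"
proof -
  have "{z \<in> elts l. \<not> (z \<in> q \<longrightarrow> z \<in> p)} = q - p" using assms unfolding conds_iff by blast
  then show ?thesis unfolding below_def eventually_dual by simp
qed

lemma ult_mem_iff:
  assumes "q \<in> conds"
  shows "ult_mem (elts l) I g f q \<longleftrightarrow> (\<forall>\<^sub>F z in dual_filter. z \<in> q \<longrightarrow> g z \<in> elts (f z))"
proof -
  have "{z \<in> elts l. \<not> (z \<in> q \<longrightarrow> g z \<in> elts (f z))} = q - {z \<in> elts l. g z \<in> elts (f z)}"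
    using assms unfolding conds_iff by blast
  then show ?thesis unfolding ult_mem_def f_generic_def below_def eventually_dual by simp
qed

lemma below_refl: "below I p p"
  unfolding below_def using empty_ideal by simp

lemma below_trans: "below I r q \<Longrightarrow> below I q p \<Longrightarrow> below I r p"
  unfolding below_def by (rule ideal_subset[OF ideal_Un, of "r - q" "q - p"]) blast+

lemma coll_member:
  assumes "coll f x p" "q \<in> conds" "below I q p" "ult_mem (elts l) I g f q"
  shows "\<exists>r\<in>conds. below I r q \<and> (\<exists>y\<in>elts x. coll g y r)"
  using assms(1)
proof cases
  case 1
  then have "f_ex (elts l) I (elts x) (\<lambda>y. coll g y) q"
    using assms(2-4) unfolding f_and_def f_all_def f_imp_def by blast
  then show ?thesis using assms(2) below_refl unfolding f_ex_def by blast
qed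

lemma coll_represented:
  assumes "coll f x p" "q \<in> conds" "below I q p" "y \<in> elts x"
  shows "\<exists>r\<in>conds. below I r q \<and> (\<exists>g. ult_mem (elts l) I g f r \<and> coll g y r)"
  using assms(1)
proof cases
  case 1
  then have "f_ex (elts l) I UNIV (\<lambda>g. f_and (ult_mem (elts l) I g f) (coll g y)) p"
    using assms(4) unfolding f_and_def f_all_def by blast
  then show ?thesis using assms(2,3) unfolding f_ex_def f_and_def by blast
qed

lemma collI:
  assumes "\<And>g q. q \<in> conds \<Longrightarrow> below I q p \<Longrightarrow> ult_mem (elts l) I g f q \<Longrightarrow>
      \<exists>r\<in>conds. below I r q \<and> (\<exists>y\<in>elts x. coll g y r)"
    and "\<And>q y. q \<in> conds \<Longrightarrow> below I q p \<Longrightarrow> y \<in> elts x \<Longrightarrow>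
      \<exists>r\<in>conds. below I r q \<and> (\<exists>g. ult_mem (elts l) I g f r \<and> coll g y r)"
  shows "coll f x p"
proof (rule ult_collapse.intros, unfold f_and_def, intro conjI)
  have ult_mem_mono: "ult_mem (elts l) I g f r" if "ult_mem (elts l) I g f q" "below I r q" for g q r
    using that below_trans unfolding ult_mem_def f_generic_def by blast
  show "f_all UNIV (\<lambda>g. f_imp (elts l) I (ult_mem (elts l) I g f)
      (f_ex (elts l) I (elts x) (coll g))) p"
    unfolding f_all_def f_imp_def f_ex_def
    using assms(1) below_trans ult_mem_mono by blast
  show "f_all (elts x) (\<lambda>y. f_ex (elts l) I UNIV (\<lambda>g p. ult_mem (elts l) I g f p \<and> coll g y p)) p"
    unfolding f_all_def f_ex_def using assms(2) by blast
qed

lemma coll_mono: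
  assumes "coll f x p" "below I q p"
  shows "coll f x q"
  by (rule collI) (use coll_member[OF assms(1)] coll_represented[OF assms(1)] below_trans[OF _ assms(2)] in blast)+

lemma coll_cong:
  assumes f: "coll f x p" and eq: "\<forall>\<^sub>F z in dual_filter. z \<in> p \<longrightarrow> f z = f' z"
  shows "coll f' x p"
proof -
  have *: "ult_mem (elts l) I g f q \<longleftrightarrow> ult_mem (elts l) I g f' q" if q: "q \<in> conds" "below I q p" for g q
  proof -
    have "\<forall>\<^sub>F z in dual_filter. z \<in> q \<longrightarrow> f z = f' z"
      using eq q(2)[unfolded below_iff[OF q(1)]] by eventually_elim blast
    then show ?thesis unfolding ult_mem_iff[OF q(1)]
      by (auto elim: eventually_elim2)
  qed
  show ?thesis
  proof (rule collI)
    fix g q assume "q \<in> conds" "below I q p" "ult_mem (elts l) I g f' q"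
    then show "\<exists>r\<in>conds. below I r q \<and> (\<exists>y\<in>elts x. coll g y r)"
      using coll_member[OF f] * by blast
  next
    fix q y assume "q \<in> conds" "below I q p" "y \<in> elts x"
    then show "\<exists>r\<in>conds. below I r q \<and> (\<exists>g. ult_mem (elts l) I g f' r \<and> coll g y r)"
      using coll_represented[OF f] * below_trans by meson
  qed
qed

text \<open>Induction on \<open>x\<close>. If \<open>f z\<close> is positively often not included in
  \<open>g z\<close>, choose \<open>h z\<close> in the difference. Below some condition
  \<open>h\<close> collapses to some \<open>y\<close> in \<open>x\<close>, to which a member of
  \<open>g\<close> also collapses; by induction the two functions agree there, a
  contradiction.\<close>

lemma coll_unique:
  assumes "p \<in> conds" "coll f x p" "coll g x p"
  shows "\<forall>\<^sub>F z in dual_filter. z \<in> p \<longrightarrow> f z = g z"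
  using assms
proof (induction x arbitrary: f g p rule: mem_induct)
  case (1 x)
  have no: "\<not> (\<exists>\<^sub>F z in dual_filter. z \<in> p \<and> \<not> elts (f z) \<subseteq> elts (g z))"
    if f: "coll f x p" and g: "coll g x p" for f g
  proof
    assume "\<exists>\<^sub>F z in dual_filter. z \<in> p \<and> \<not> elts (f z) \<subseteq> elts (g z)"
    then have q: "{z \<in> elts l. z \<in> p \<and> \<not> elts (f z) \<subseteq> elts (g z)} \<in> conds" (is "?q \<in> _")
      by (rule conds_Collect)
    define h where "h z = (SOME y. y \<in> elts (f z) \<and> y \<notin> elts (g z))" for z
    have h: "h z \<in> elts (f z) \<and> h z \<notin> elts (g z)" if "z \<in> ?q" for z
      unfolding h_def by (rule someI_ex) (use that in blast)
    have qp: "below I ?q p" unfolding below_iff[OF q] by (intro always_eventually) blast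
    have "ult_mem (elts l) I h f ?q"
      unfolding ult_mem_iff[OF q] using h by (intro always_eventually) blast
    then obtain r y where r: "r \<in> conds" "below I r ?q" "y \<in> elts x" "coll h y r"
      using coll_member[OF f q qp] by blast
    obtain s g' where s: "s \<in> conds" "below I s r" "ult_mem (elts l) I g' g s" "coll g' y s"
      using coll_represented[OF g r(1) below_trans[OF r(2) qp] r(3)] by blast
    have "\<forall>\<^sub>F z in dual_filter. z \<in> s \<longrightarrow> h z = g' z"
      using 1(1)[OF r(3) s(1) coll_mono[OF r(4) s(2)] s(4)] .
    then have "\<forall>\<^sub>F z in dual_filter. z \<notin> s"
      using s(3)[unfolded ult_mem_iff[OF s(1)]] below_trans[OF s(2) r(2), unfolded below_iff[OF s(1)]]
      by eventually_elim (use h in metis)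
    then show False using s(1) unfolding conds_iff frequently_def by blast
  qed
  show ?case
    using no[OF 1(3,4)] no[OF 1(4,3)] unfolding not_frequently
    by eventually_elim (metis extensionality subset_antisym)
qed

section \<open>Functions representing sets of the ground model\<close>

definition represents :: "('v \<Rightarrow> 'v) \<Rightarrow> 'v \<Rightarrow> bool" where
  "represents f x \<longleftrightarrow> (\<forall>p\<in>conds. coll f x p)"

text \<open>The recursive clauses of the collapse in filter form: a member of \<open>f\<close> need
  only agree on a positive set with a representing function, because such positive sets are dense
  below any condition.\<close>

lemma representsI:
  assumes mem: "\<And>g P. \<exists>\<^sub>F z in dual_filter. P z \<and> g z \<in> elts (f z) \<Longrightarrow>
      \<exists>y\<in>elts x. \<exists>g'. represents g' y \<and> (\<exists>\<^sub>F z in dual_filter. P z \<and> g z = g' z)"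
    and rep: "\<And>y. y \<in> elts x \<Longrightarrow> \<exists>g. represents g y \<and> (\<forall>\<^sub>F z in dual_filter. g z \<in> elts (f z))"
  shows "represents f x"
  unfolding represents_def
proof (intro ballI collI)
  fix g p q assume q: "q \<in> conds" and g: "ult_mem (elts l) I g f q"
  have "\<exists>\<^sub>F z in dual_filter. z \<in> q \<and> g z \<in> elts (f z)"
    using frequently_eventually_conj[OF conjunct2[OF q[unfolded conds_iff]] g[unfolded ult_mem_iff[OF q]]]
    by (rule frequently_elim1) blast
  then obtain y g' where y: "y \<in> elts x" "represents g' y"
      "\<exists>\<^sub>F z in dual_filter. z \<in> q \<and> g z = g' z"
    using mem[of "\<lambda>z. z \<in> q" g] by blast
  let ?r = "{z \<in> elts l. z \<in> q \<and> g z = g' z}"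
  have r: "?r \<in> conds" by (rule conds_Collect[OF y(3)])
  have "coll g' y ?r" using y(2) r unfolding represents_def by blast
  then have "coll g y ?r" by (rule coll_cong) (intro always_eventually, auto)
  moreover have "below I ?r q" unfolding below_iff[OF r] by (intro always_eventually) blast
  ultimately show "\<exists>r\<in>conds. below I r q \<and> (\<exists>y\<in>elts x. coll g y r)" using r y(1) by blast
next
  fix p q y assume q: "q \<in> conds" and y: "y \<in> elts x"
  obtain g where g: "represents g y" "\<forall>\<^sub>F z in dual_filter. g z \<in> elts (f z)" using rep[OF y] by blast
  have "ult_mem (elts l) I g f q"
    unfolding ult_mem_iff[OF q] by (rule eventually_mono[OF g(2)]) blast
  then show "\<exists>r\<in>conds. below I r q \<and> (\<exists>g. ult_mem (elts l) I g f r \<and> coll g y r)"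
    using q g(1) below_refl unfolding represents_def by blast
qed

text \<open>The generic embedding fixes every ordinal below \<open>l\<close>: almost all
  \<open>z\<close> exceed \<open>x\<close>, so a function with values in \<open>x\<close> is
  regressive and, by Fodor, constant on a positive set.\<close>

lemma represents_const:
  assumes "x \<in> elts l"
  shows "represents (\<lambda>_. x) x"
  using assms
proof (induction x rule: mem_induct)
  case (1 x)
  have sub: "elts x \<subseteq> elts l" by (rule ordinal_subset[OF ordinal 1(2)])
  show ?case
  proof (rule representsI)
    fix g P assume fr: "\<exists>\<^sub>F z in dual_filter. P z \<and> g z \<in> elts x"
    have "\<exists>\<^sub>F z in dual_filter. (P z \<and> g z \<in> elts x) \<and> g z \<in> elts z"
    proof (rule frequently_rev_mp[OF fr])
      show "\<forall>\<^sub>F z in dual_filter. P z \<and> g z \<in> elts x \<longrightarrow> (P z \<and> g z \<in> elts x) \<and> g z \<in> elts z"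
        using eventually_mem[OF 1(2)] eventually_in
        by eventually_elim (use ordinal_mem[OF ordinal] ordinal_trans in blast)
    qed
    then obtain y where y: "\<exists>\<^sub>F z in dual_filter. (P z \<and> g z \<in> elts x) \<and> g z = y"
      using pressing_down[of "\<lambda>z. P z \<and> g z \<in> elts x" g] by blast
    then have "y \<in> elts x" by (auto dest: frequently_ex)
    moreover have "\<exists>\<^sub>F z in dual_filter. P z \<and> g z = y"
      using y by (rule frequently_elim1) blast
    ultimately show "\<exists>y\<in>elts x. \<exists>g'. represents g' y \<and> (\<exists>\<^sub>F z in dual_filter. P z \<and> g z = g' z)"
      using 1(1) sub by (intro bexI[of _ y] exI[of _ "\<lambda>_. y"]) blast+
  next
    fix y assume "y \<in> elts x"
    then show "\<exists>g. represents g y \<and> (\<forall>\<^sub>F z in dual_filter. g z \<in> elts x)"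
      using 1(1) sub by (intro exI[of _ "\<lambda>_. y"]) auto
  qed
qed

text \<open>A function choosing a member of \<open>a\<close> below \<open>z\<close> is regressive,
  hence constant on a positive set, and constants represent themselves.\<close>

lemma represents_subset:
  assumes "elts a \<subseteq> elts l"
  shows "represents (\<lambda>z. set_of (elts a \<inter> elts z)) a"
proof -
  have elts: "elts (set_of (elts a \<inter> elts z)) = elts a \<inter> elts z" for z
    by (rule elts_set_of_subset) blast
  show ?thesis
  proof (rule representsI; unfold elts)
    fix g P assume "\<exists>\<^sub>F z in dual_filter. P z \<and> g z \<in> elts a \<inter> elts z"
    then have "\<exists>\<^sub>F z in dual_filter. (P z \<and> g z \<in> elts a) \<and> g z \<in> elts z"
      by (rule frequently_elim1) blast
    then obtain y where y: "\<exists>\<^sub>F z in dual_filter. (P z \<and> g z \<in> elts a) \<and> g z = y"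
      using pressing_down[of "\<lambda>z. P z \<and> g z \<in> elts a" g] by blast
    then have "y \<in> elts a" by (auto dest: frequently_ex)
    moreover have "\<exists>\<^sub>F z in dual_filter. P z \<and> g z = y"
      using y by (rule frequently_elim1) blast
    ultimately show "\<exists>y\<in>elts a. \<exists>g'. represents g' y \<and> (\<exists>\<^sub>F z in dual_filter. P z \<and> g z = g' z)"
      using represents_const assms by (intro bexI[of _ y] exI[of _ "\<lambda>_. y"]) blast+
  next
    fix y assume y: "y \<in> elts a"
    then have "\<forall>\<^sub>F z in dual_filter. y \<in> elts z" using assms eventually_mem by blast
    then have "\<forall>\<^sub>F z in dual_filter. y \<in> elts a \<inter> elts z"
      by (rule eventually_mono) (use y in blast)
    then show "\<exists>g. represents g y \<and> (\<forall>\<^sub>F z in dual_filter. g z \<in> elts a \<inter> elts z)"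
      using represents_const[of y] y assms by (intro exI[of _ "\<lambda>_. y"]) blast
  qed
qed

text \<open>Induction on \<open>b\<close>: members of \<open>can e b z\<close> are values
  \<open>can e x z\<close> with \<open>x\<close> in the hull, and pressing down on the hull makes
  \<open>x\<close> constant.\<close>

lemma represents_can:
  assumes "is_ordinal b" "inj_on e (elts b)" "e ` elts b \<subseteq> elts l"
  shows "represents (can e b) b"
  using assms
proof (induction b rule: mem_induct)
  case (1 b)
  have IH: "represents (can e x) x" if x: "x \<in> elts b" for x
    using ordinal_subset[OF 1(2) x] 1(3,4)
    by (intro 1(1)[OF x] ordinal_mem[OF 1(2) x]) (blast intro: inj_on_subset)+
  show ?case
  proof (rule representsI)
    fix g P assume fr: "\<exists>\<^sub>F z in dual_filter. P z \<and> g z \<in> elts (can e b z)"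
    define c where "c z = (SOME x. x \<in> elts b \<and> e x \<in> elts z \<and> g z = can e x z)" for z
    have c: "c z \<in> elts b \<and> e (c z) \<in> elts z \<and> g z = can e (c z) z" if "g z \<in> elts (can e b z)" for z
      unfolding c_def by (rule someI_ex) (use that elts_can[OF 1(2)] in blast)
    have "\<exists>\<^sub>F z in dual_filter. (P z \<and> g z = can e (c z) z) \<and> c z \<in> elts b \<and> e (c z) \<in> elts z"
      using fr by (rule frequently_elim1) (use c in blast)
    then obtain x where x: "x \<in> elts b" "\<exists>\<^sub>F z in dual_filter. (P z \<and> g z = can e (c z) z) \<and> c z = x"
      using pressing_down_hull[OF 1(3,4), of "\<lambda>z. P z \<and> g z = can e (c z) z" c] by blast
    have "\<exists>\<^sub>F z in dual_filter. P z \<and> g z = can e x z"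
      using x(2) by (rule frequently_elim1) blast
    then show "\<exists>y\<in>elts b. \<exists>g'. represents g' y \<and> (\<exists>\<^sub>F z in dual_filter. P z \<and> g z = g' z)"
      using IH x(1) by blast
  next
    fix x assume x: "x \<in> elts b"
    then have "\<forall>\<^sub>F z in dual_filter. e x \<in> elts z" using 1(4) eventually_mem by blast
    then have "\<forall>\<^sub>F z in dual_filter. can e x z \<in> elts (can e b z)"
      by (rule eventually_mono) (rule can_mono[OF 1(2) x])
    then show "\<exists>g. represents g x \<and> (\<forall>\<^sub>F z in dual_filter. g z \<in> elts (can e b z))"
      using IH[OF x] by blast
  qed
qed

text \<open>Eliminates forcing: below a suitable condition \<open>g\<close> collapses to some
  \<open>y\<close> in \<open>x\<close>, and uniqueness of the collapse identifies \<open>g\<close>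
  there with any function representing \<open>y\<close>.\<close>

lemma coll_member_eq:
  assumes p: "coll f x p" and p_sub: "p \<subseteq> elts l"
    and fr: "\<exists>\<^sub>F z in dual_filter. z \<in> p \<and> P z \<and> g z \<in> elts (f z)"
  shows "\<exists>y\<in>elts x. \<forall>c. represents c y \<longrightarrow> (\<exists>\<^sub>F z in dual_filter. z \<in> p \<and> P z \<and> g z = c z)"
proof -
  have q: "{z \<in> elts l. z \<in> p \<and> P z \<and> g z \<in> elts (f z)} \<in> conds" (is "?q \<in> _")
    by (rule conds_Collect[OF fr])
  have "below I ?q p" "ult_mem (elts l) I g f ?q"
    unfolding below_iff[OF q] ult_mem_iff[OF q] by (intro always_eventually; blast)+
  then obtain r y where r: "r \<in> conds" "below I r ?q" "y \<in> elts x" "coll g y r"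
    using coll_member[OF p q] by blast
  have "\<exists>\<^sub>F z in dual_filter. z \<in> p \<and> P z \<and> g z = c z" if "represents c y" for c
  proof -
    have "\<forall>\<^sub>F z in dual_filter. z \<in> r \<longrightarrow> g z = c z"
      using coll_unique[OF r(1,4)] that r(1) unfolding represents_def by blast
    then have "\<forall>\<^sub>F z in dual_filter. z \<in> r \<longrightarrow> z \<in> p \<and> P z \<and> g z = c z"
      using r(2)[unfolded below_iff[OF r(1)]] by eventually_elim blast
    then show ?thesis using r(1) unfolding conds_iff by (blast intro: frequently_rev_mp)
  qed
  then show ?thesis using r(3) by blast
qed

lemma coll_represented_mem:
  assumes p: "coll f x p" and y: "y \<in> elts x" "represents c y"
  shows "\<forall>\<^sub>F z in dual_filter. z \<in> p \<longrightarrow> c z \<in> elts (f z)"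
proof (rule ccontr)
  assume "\<not> ?thesis"
  then have fr: "\<exists>\<^sub>F z in dual_filter. z \<in> p \<and> c z \<notin> elts (f z)"
    unfolding frequently_def by simp
  have q: "{z \<in> elts l. z \<in> p \<and> c z \<notin> elts (f z)} \<in> conds" (is "?q \<in> _")
    by (rule conds_Collect[OF fr])
  have "below I ?q p" unfolding below_iff[OF q] by (intro always_eventually) blast
  then obtain r g where r: "r \<in> conds" "below I r ?q" "ult_mem (elts l) I g f r" "coll g y r"
    using coll_represented[OF p q _ y(1)] by blast
  have "\<forall>\<^sub>F z in dual_filter. z \<in> r \<longrightarrow> g z = c z"
    using coll_unique[OF r(1,4)] y(2) r(1) unfolding represents_def by blast
  then have "\<forall>\<^sub>F z in dual_filter. z \<notin> r"
    using r(2)[unfolded below_iff[OF r(1)]] r(3)[unfolded ult_mem_iff[OF r(1)]]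
    by eventually_elim auto
  then show False using r(1) unfolding conds_iff frequently_def by blast
qed

end

section \<open>Power sets in the generic ultrapower\<close>

locale generic_powerset = square_coding k l m t e F + normal_ideal l I
  for k l m :: "'v::set_universe" and t e F I +
  fixes p :: "'v set" and f :: "'v \<Rightarrow> 'v" and P :: 'v
  assumes p: "p \<in> conds"
    and P: "elts P = {a. elts a \<subseteq> elts l}"
    and f: "coll f P p"
    and embed: "coll (ult_embed l) m (elts l)"
begin

lemma p_subset: "p \<subseteq> elts l"
  using p conds_iff by blast

lemma e_image: "a \<in> elts m \<Longrightarrow> e a ` elts a \<subseteq> elts l"
  using e(2) by blast

lemma m_trans: "a \<in> elts m \<Longrightarrow> b \<in> elts a \<Longrightarrow> b \<in> elts m"
  using ordinal_trans[OF ordinal_m] .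

lemma m_ordinal: "a \<in> elts m \<Longrightarrow> is_ordinal a"
  using ordinal_mem[OF ordinal_m] .

text \<open>Together with the next lemma this describes \<open>f z\<close> for \<open>z\<close> in
  \<open>p\<close>: modulo \<open>I\<close>, its members are the traces on \<open>z\<close> of fixed
  subsets of \<open>l\<close>.\<close>

lemma eventually_subset_mem:
  assumes "A \<subseteq> elts l"
  shows "\<forall>\<^sub>F z in dual_filter. z \<in> p \<longrightarrow> set_of (A \<inter> elts z) \<in> elts (f z)"
proof -
  have A: "elts (set_of A) = A" by (rule elts_set_of_subset[OF assms])
  show ?thesis
    using coll_represented_mem[OF f, of "set_of A" "\<lambda>z. set_of (A \<inter> elts z)"]
      represents_subset[of "set_of A"] assms P by (simp add: A)
qed

lemma frequently_mem_subset:
  assumes "\<exists>\<^sub>F z in dual_filter. z \<in> p \<and> Q z \<and> g z \<in> elts (f z)"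
  shows "\<exists>A. A \<subseteq> elts l \<and> (\<exists>\<^sub>F z in dual_filter. z \<in> p \<and> Q z \<and> g z = set_of (A \<inter> elts z))"
proof -
  obtain y where y: "y \<in> elts P"
      "\<And>c. represents c y \<Longrightarrow> \<exists>\<^sub>F z in dual_filter. z \<in> p \<and> Q z \<and> g z = c z"
    using coll_member_eq[OF f p_subset assms] by blast
  then have "elts y \<subseteq> elts l" using P by blast
  then show ?thesis using y(2)[OF represents_subset] by blast
qed

text \<open>The generic embedding sends \<open>l\<close> to \<open>m\<close>, so a function into
  \<open>l\<close> represents, below some condition, an ordinal \<open>a\<close> of
  \<open>m\<close>, and the canonical function of \<open>a\<close> does so too.\<close>

lemma frequently_ordinal:
  assumes "\<exists>\<^sub>F z in dual_filter. Q z \<and> g z \<in> elts l"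
  shows "\<exists>a\<in>elts m. \<exists>\<^sub>F z in dual_filter. Q z \<and> g z = can (e a) a z"
proof -
  have "\<exists>\<^sub>F z in dual_filter. z \<in> elts l \<and> Q z \<and> g z \<in> elts (ult_embed l z)"
    using frequently_eventually_conj[OF assms eventually_in]
    unfolding ult_embed_def by (rule frequently_elim1) blast
  then obtain a where a: "a \<in> elts m"
      "\<And>c. represents c a \<Longrightarrow> \<exists>\<^sub>F z in dual_filter. z \<in> elts l \<and> Q z \<and> g z = c z"
    using coll_member_eq[OF embed subset_refl] by blast
  have "\<exists>\<^sub>F z in dual_filter. z \<in> elts l \<and> Q z \<and> g z = can (e a) a z"
    by (intro a(2) represents_can m_ordinal[OF a(1)] e(1)[OF a(1)] e_image[OF a(1)])
  then show ?thesis using a(1) by (blast intro: frequently_elim1)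
qed

section \<open>Pairing on \<open>l\<close> and codes of ordinals\<close>

definition pr :: "'v \<Rightarrow> 'v \<Rightarrow> 'v" where
  "pr x y = (SOME g. inj_on g (elts l \<times> elts l) \<and> g ` (elts l \<times> elts l) \<subseteq> elts l) (x, y)"

lemma infinite_l: "infinite (elts l)"
proof -
  have "k \<in> elts l" using k(1) l(3) unfolding is_cardinal_def by blast
  then have "elts k \<subseteq> elts l" using ordinal_subset[OF ordinal_l] by blast
  then show ?thesis using k(2) finite_subset by blast
qed

lemma pr_mem: "x \<in> elts l \<Longrightarrow> y \<in> elts l \<Longrightarrow> pr x y \<in> elts l"
  and pr_eq: "x \<in> elts l \<Longrightarrow> y \<in> elts l \<Longrightarrow> x' \<in> elts l \<Longrightarrow> y' \<in> elts l \<Longrightarrow>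
    pr x y = pr x' y' \<Longrightarrow> x = x' \<and> y = y'"
proof -
  let ?g = "SOME g. inj_on g (elts l \<times> elts l) \<and> g ` (elts l \<times> elts l) \<subseteq> elts l"
  have "\<exists>g. inj_on g (elts l \<times> elts l) \<and> g ` (elts l \<times> elts l) \<subseteq> elts l"
    using Times_lepoll[OF infinite_l lepoll_refl lepoll_refl] unfolding lepoll_def .
  then have g: "inj_on ?g (elts l \<times> elts l) \<and> ?g ` (elts l \<times> elts l) \<subseteq> elts l"
    by (rule someI_ex)
  show "x \<in> elts l \<Longrightarrow> y \<in> elts l \<Longrightarrow> pr x y \<in> elts l"
    using g unfolding pr_def by blast
  show "x \<in> elts l \<Longrightarrow> y \<in> elts l \<Longrightarrow> x' \<in> elts l \<Longrightarrow> y' \<in> elts l \<Longrightarrow>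
    pr x y = pr x' y' \<Longrightarrow> x = x' \<and> y = y'"
    using inj_onD[OF conjunct1[OF g], of "(x, y)" "(x', y')"] unfolding pr_def by blast
qed

definition pr_closed :: "'v \<Rightarrow> bool" where
  "pr_closed z \<longleftrightarrow> z \<in> elts l \<and> (\<forall>x\<in>elts z. \<forall>y\<in>elts z. pr x y \<in> elts z)
    \<and> (\<forall>x\<in>elts l. \<forall>y\<in>elts l. pr x y \<in> elts z \<longrightarrow> x \<in> elts z \<and> y \<in> elts z)"

lemma eventually_pr_closed: "\<forall>\<^sub>F z in dual_filter. pr_closed z"
proof -
  have "\<forall>\<^sub>F z in dual_filter. \<forall>x\<in>elts z. \<forall>y\<in>elts z. pr x y \<in> elts z"
    by (intro eventually_diagonal eventually_mem pr_mem)
  moreover have "\<forall>\<^sub>F z in dual_filter. \<forall>u\<in>elts z. \<forall>x\<in>elts l. \<forall>y\<in>elts l. pr x y = u \<longrightarrow> x \<in> elts z \<and> y \<in> elts z"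
  proof (rule eventually_diagonal)
    fix u
    show "\<forall>\<^sub>F z in dual_filter. \<forall>x\<in>elts l. \<forall>y\<in>elts l. pr x y = u \<longrightarrow> x \<in> elts z \<and> y \<in> elts z"
    proof (cases "\<exists>x\<in>elts l. \<exists>y\<in>elts l. pr x y = u")
      case True
      then obtain x y where xy: "x \<in> elts l" "y \<in> elts l" "pr x y = u" by blast
      show ?thesis
        using eventually_mem[OF xy(1)] eventually_mem[OF xy(2)]
        by eventually_elim (use xy pr_eq in blast)
    qed (simp add: always_eventually)
  qed
  ultimately show ?thesis
    using eventually_in by eventually_elim (unfold pr_closed_def, blast)
qed

text \<open>A code is the image of the order of an ordinal; it is reflexive, so that it determines its field.\<close>

definition code :: "'v \<Rightarrow> ('v \<Rightarrow> 'v) \<Rightarrow> 'v set" where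
  "code b h = {pr (h x) (h y) |x y. x \<in> elts b \<and> y \<in> elts b \<and> (x \<in> elts y \<or> x = y)}"

text \<open>The counterpart at a single \<open>z\<close> of the fact that \<open>P\<close> contains
  a code of every ordinal below \<open>m\<close>.\<close>

definition codes :: "'v \<Rightarrow> 'v \<Rightarrow> ('v \<Rightarrow> 'v) \<Rightarrow> bool" where
  "codes z b h \<longleftrightarrow> inj_on h (elts b) \<and> h ` elts b \<subseteq> elts z \<and> set_of (code b h) \<in> elts (f z)"

lemma code_subset: "h ` elts b \<subseteq> elts l \<Longrightarrow> code b h \<subseteq> elts l"
  unfolding code_def using pr_mem by blast

text \<open>Take \<open>h\<close> to be \<open>e a\<close> after the inverse of the collapse of the
  hull. As \<open>z\<close> is closed under pairing and unpairing, the code of \<open>a\<close> cut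
  down to \<open>z\<close> is the code of the collapsed hull.\<close>

lemma code_of_can:
  assumes a: "a \<in> elts m" and z: "pr_closed z"
  shows "\<exists>h. inj_on h (elts (can (e a) a z)) \<and> h ` elts (can (e a) a z) \<subseteq> elts z
    \<and> code (can (e a) a z) h = code a (e a) \<inter> elts z"
proof -
  let ?D = "{x \<in> elts a. e a x \<in> elts z}" and ?c = "\<lambda>x. can (e a) x z"
  have oa: "is_ordinal a" using m_ordinal[OF a] .
  have oD: "is_ordinal x" if "x \<in> ?D" for x using that ordinal_mem[OF oa] by blast
  have img: "elts (?c a) = ?c ` ?D" by (rule elts_can[OF oa])
  have inj: "inj_on ?c ?D" by (rule inj_onI) (use can_eq_iff oD in blast)
  define h where "h = e a \<circ> inv_into ?D ?c"
  have h: "h (?c x) = e a x" if "x \<in> ?D" for x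
    unfolding h_def using inv_into_f_f[OF inj that] by simp
  have iff: "?c x \<in> elts (?c y) \<or> ?c x = ?c y \<longleftrightarrow> x \<in> elts y \<or> x = y" if "x \<in> ?D" "y \<in> ?D" for x y
    using that can_mem_iff[OF oD oD] can_eq_iff[OF oD oD] by blast
  have "inj_on h (?c ` ?D)"
  proof (rule inj_onI)
    fix v w assume vw: "v \<in> ?c ` ?D" "w \<in> ?c ` ?D" "h v = h w"
    then obtain x y where xy: "x \<in> ?D" "y \<in> ?D" "v = ?c x" "w = ?c y" by blast
    then have "x = y" using vw(3) h inj_onD[OF e(1)[OF a], of x y] by auto
    then show "v = w" using xy by blast
  qed
  moreover have "h ` ?c ` ?D \<subseteq> elts z" using h by auto
  moreover have "code (?c a) h = code a (e a) \<inter> elts z"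
  proof (intro equalityI subsetI)
    fix u assume "u \<in> code (?c a) h"
    then obtain x y where xy: "x \<in> ?D" "y \<in> ?D" "u = pr (h (?c x)) (h (?c y))" "?c x \<in> elts (?c y) \<or> ?c x = ?c y"
      unfolding code_def img by blast
    then have "u = pr (e a x) (e a y)" "x \<in> elts y \<or> x = y" using h iff by simp_all
    then show "u \<in> code a (e a) \<inter> elts z"
      using xy z unfolding code_def pr_closed_def by blast
  next
    fix u assume "u \<in> code a (e a) \<inter> elts z"
    then obtain x y where xy: "x \<in> elts a" "y \<in> elts a" "u = pr (e a x) (e a y)" "x \<in> elts y \<or> x = y" "u \<in> elts z"
      unfolding code_def by blast
    then have D: "x \<in> ?D" "y \<in> ?D" using z e(2)[OF a] unfolding pr_closed_def by blast+
    then have "u = pr (h (?c x)) (h (?c y))" using h xy by simp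
    moreover have "?c x \<in> elts (?c y) \<or> ?c x = ?c y" using iff[OF D] xy(4) by blast
    ultimately show "u \<in> code (?c a) h" unfolding code_def img using D by blast
  qed
  ultimately show ?thesis unfolding img by blast
qed

text \<open>An uncoded ordinal chosen at positively many \<open>z\<close> equals the canonical
  function of a fixed \<open>a\<close> on a positive set. But the code of \<open>a\<close> is a
  subset of \<open>l\<close>, and its trace on \<open>z\<close> is in \<open>f z\<close> and codes
  that value.\<close>

lemma eventually_codes: "\<forall>\<^sub>F z in dual_filter. z \<in> p \<longrightarrow> (\<forall>b\<in>elts l. \<exists>h. codes z b h)"
proof (rule ccontr)
  assume "\<not> ?thesis"
  then have fr: "\<exists>\<^sub>F z in dual_filter. z \<in> p \<and> (\<exists>b\<in>elts l. \<forall>h. \<not> codes z b h)"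
    unfolding frequently_def by simp
  define b where "b z = (SOME b. b \<in> elts l \<and> (\<forall>h. \<not> codes z b h))" for z
  have b: "b z \<in> elts l \<and> (\<forall>h. \<not> codes z (b z) h)" if "\<exists>b\<in>elts l. \<forall>h. \<not> codes z b h" for z
    unfolding b_def by (rule someI_ex) (use that in blast)
  have "\<exists>\<^sub>F z in dual_filter. (z \<in> p \<and> (\<forall>h. \<not> codes z (b z) h)) \<and> b z \<in> elts l"
    using fr by (rule frequently_elim1) (use b in blast)
  then obtain a where a: "a \<in> elts m"
      "\<exists>\<^sub>F z in dual_filter. (z \<in> p \<and> (\<forall>h. \<not> codes z (b z) h)) \<and> b z = can (e a) a z"
    using frequently_ordinal[of "\<lambda>z. z \<in> p \<and> (\<forall>h. \<not> codes z (b z) h)" b] by blast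
  have "\<forall>\<^sub>F z in dual_filter. z \<in> p \<longrightarrow> set_of (code a (e a) \<inter> elts z) \<in> elts (f z)"
    by (rule eventually_subset_mem[OF code_subset[OF e_image[OF a(1)]]])
  then have "\<forall>\<^sub>F z in dual_filter. z \<in> p \<longrightarrow> (\<exists>h. codes z (can (e a) a z) h)"
    using eventually_pr_closed
  proof eventually_elim
    case (elim z)
    show ?case
      using code_of_can[OF a(1) elim(2)] elim(1) unfolding codes_def by metis
  qed
  then have "\<forall>\<^sub>F z in dual_filter. \<not> ((z \<in> p \<and> (\<forall>h. \<not> codes z (b z) h)) \<and> b z = can (e a) a z)"
    by (rule eventually_mono) metis
  then show False using a(2) unfolding frequently_def by blast
qed

text \<open>The relation \<open>R\<close> read from \<open>U\<close> is a well-order, since its part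
  inside each \<open>z\<close> with \<open>W z\<close> is isomorphic to \<open>can g c z\<close>.
  Its order type has the same canonical function as \<open>c\<close> on a positive set, hence is
  \<open>c\<close>; uniqueness of isomorphisms then makes the local decodings \<open>h z\<close>
  values of one global \<open>u\<close>.\<close>

lemma decode:
  assumes c: "is_ordinal c" and g: "inj_on g (elts c)" "g ` elts c \<subseteq> elts l"
    and W: "\<exists>\<^sub>F z in dual_filter. W z"
    and Wz: "\<And>z. W z \<Longrightarrow> pr_closed z" "\<And>z. W z \<Longrightarrow> inj_on (h z) (elts (can g c z))"
      "\<And>z. W z \<Longrightarrow> h z ` elts (can g c z) \<subseteq> elts z"
      "\<And>z. W z \<Longrightarrow> code (can g c z) (h z) = U \<inter> elts z"
  shows "\<exists>u. inj_on u (elts c) \<and> u ` elts c \<subseteq> elts l \<and>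
    (\<forall>\<^sub>F z in dual_filter. W z \<longrightarrow> (\<forall>x\<in>elts c. g x \<in> elts z \<longrightarrow> h z (can g x z) = u x))"
proof -
  \<comment> \<open>Codes are reflexive, so the diagonal of \<open>U\<close> gives the field of the
    coded order.\<close>
  define A where "A = {v \<in> elts l. pr v v \<in> U}"
  define R where "R = {(v, w). v \<in> A \<and> w \<in> A \<and> v \<noteq> w \<and> pr v w \<in> U}"
  have A_l: "A \<subseteq> elts l" unfolding A_def by blast
  have z_l: "elts z \<subseteq> elts l" if "W z" for z
    using Wz(1)[OF that] ordinal_subset[OF ordinal_l] unfolding pr_closed_def by blast
  have img: "h z ` elts (can g c z) = A \<inter> elts z" if z: "W z" for z
  proof (intro equalityI subsetI)
    fix v assume "v \<in> h z ` elts (can g c z)"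
    then obtain x where x: "x \<in> elts (can g c z)" "v = h z x" by blast
    then have "pr v v \<in> U" using Wz(4)[OF z] unfolding code_def by blast
    moreover have "v \<in> elts z" using x Wz(3)[OF z] by blast
    ultimately show "v \<in> A \<inter> elts z" using z_l[OF z] unfolding A_def by blast
  next
    fix v assume v: "v \<in> A \<inter> elts z"
    then have "pr v v \<in> U \<inter> elts z" using Wz(1)[OF z] unfolding A_def pr_closed_def by blast
    then obtain x y where xy: "x \<in> elts (can g c z)" "y \<in> elts (can g c z)" "pr v v = pr (h z x) (h z y)"
      using Wz(4)[OF z] unfolding code_def by blast
    then have "v = h z x" using pr_eq[of v v "h z x" "h z y"] v Wz(3)[OF z] z_l[OF z] by blast
    then show "v \<in> h z ` elts (can g c z)" using xy by blast
  qed
  have iff: "(h z x, h z y) \<in> R \<longleftrightarrow> x \<in> elts y"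
    if z: "W z" and x: "x \<in> elts (can g c z)" and y: "y \<in> elts (can g c z)" for z x y
  proof
    assume R: "(h z x, h z y) \<in> R"
    then have "pr (h z x) (h z y) \<in> U \<inter> elts z"
      using Wz(1)[OF z] Wz(3)[OF z] x y unfolding R_def pr_closed_def by blast
    then obtain x' y' where xy: "x' \<in> elts (can g c z)" "y' \<in> elts (can g c z)"
        "x' \<in> elts y' \<or> x' = y'" "pr (h z x) (h z y) = pr (h z x') (h z y')"
      using Wz(4)[OF z] unfolding code_def by blast
    then have "h z x = h z x' \<and> h z y = h z y'"
      using x y Wz(3)[OF z] z_l[OF z] by (intro pr_eq) blast+
    then have "x = x'" "y = y'" using x y xy inj_onD[OF Wz(2)[OF z]] by blast+
    moreover have "h z x \<noteq> h z y" using R unfolding R_def by blast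
    ultimately show "x \<in> elts y" using xy by blast
  next
    assume xy: "x \<in> elts y"
    then have "x \<noteq> y" using not_mem_self by blast
    then have "h z x \<noteq> h z y" using inj_onD[OF Wz(2)[OF z]] x y by blast
    moreover have "pr (h z x) (h z y) \<in> U" using xy x y Wz(4)[OF z] unfolding code_def by blast
    ultimately show "(h z x, h z y) \<in> R" using img[OF z] x y unfolding R_def by blast
  qed
  have ocan: "is_ordinal (can g c z)" for z by (rule can_ordinal[OF c])
  \<comment> \<open>Any three points lie in a common \<open>z\<close>, so transitivity and totality
    can be checked inside an ordinal.\<close>
  have ex: "\<exists>z. W z \<and> v1 \<in> elts z \<and> v2 \<in> elts z \<and> v3 \<in> elts z"
    if v: "v1 \<in> A" "v2 \<in> A" "v3 \<in> A" for v1 v2 v3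
  proof -
    have "v1 \<in> elts l" "v2 \<in> elts l" "v3 \<in> elts l" using v A_l by blast+
    then have "\<forall>\<^sub>F z in dual_filter. v1 \<in> elts z \<and> v2 \<in> elts z \<and> v3 \<in> elts z"
      using eventually_mem by (intro eventually_conj)
    then show ?thesis using frequently_ex[OF frequently_eventually_conj[OF W]] by blast
  qed
  have trans: "trans R"
  proof (rule transI)
    fix v1 v2 v3 assume R: "(v1, v2) \<in> R" "(v2, v3) \<in> R"
    then have A: "v1 \<in> A" "v2 \<in> A" "v3 \<in> A" unfolding R_def by blast+
    then obtain z where z: "W z" "v1 \<in> elts z" "v2 \<in> elts z" "v3 \<in> elts z" using ex by blast
    then have "v1 \<in> h z ` elts (can g c z)" "v2 \<in> h z ` elts (can g c z)" "v3 \<in> h z ` elts (can g c z)"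
      using A img by blast+
    then obtain x1 x2 x3 where x: "x1 \<in> elts (can g c z)" "x2 \<in> elts (can g c z)" "x3 \<in> elts (can g c z)"
        "v1 = h z x1" "v2 = h z x2" "v3 = h z x3"
      by blast
    then have "x1 \<in> elts x2" "x2 \<in> elts x3" using R iff[OF z(1)] by blast+
    then have "x1 \<in> elts x3" using ordinal_trans[OF ordinal_mem[OF ocan x(3)]] by blast
    then show "(v1, v3) \<in> R" using iff[OF z(1)] x by blast
  qed
  have total: "(v1, v2) \<in> R \<or> v1 = v2 \<or> (v2, v1) \<in> R" if A: "v1 \<in> A" "v2 \<in> A" for v1 v2
  proof -
    obtain z where z: "W z" "v1 \<in> elts z" "v2 \<in> elts z" using ex[OF A A(2)] by blast
    then have "v1 \<in> h z ` elts (can g c z)" "v2 \<in> h z ` elts (can g c z)" using A img by blast+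
    then obtain x1 x2 where x: "x1 \<in> elts (can g c z)" "x2 \<in> elts (can g c z)" "v1 = h z x1" "v2 = h z x2"
      by blast
    then have "x1 \<in> elts x2 \<or> x1 = x2 \<or> x2 \<in> elts x1"
      using ordinal_linear ordinal_mem[OF ocan] by blast
    then show ?thesis using iff[OF z(1)] x by blast
  qed
  (* The R-minimal element of Q below z is regressive in z, hence frequently constant; so no
     appeal to the cofinality of l is needed. *)
  have "wf R"
    unfolding wf_eq_minimal
  proof (intro allI impI)
    fix Q :: "'v set" and v0 assume v0: "v0 \<in> Q"
    show "\<exists>v\<in>Q. \<forall>w. (w, v) \<in> R \<longrightarrow> w \<notin> Q"
    proof (cases "v0 \<in> A")
      case False
      then show ?thesis using v0 unfolding R_def by blast
    next
      case True
      let ?M = "\<lambda>z v. v \<in> Q \<and> (\<forall>w\<in>elts z. (w, v) \<in> R \<longrightarrow> w \<notin> Q)"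
      define v where "v z = (SOME v. v \<in> elts z \<and> ?M z v)" for z
      have v: "v z \<in> elts z \<and> ?M z (v z)" if z: "W z" "v0 \<in> elts z" for z
        unfolding v_def
      proof (rule someI_ex)
        obtain x0 where "x0 \<in> elts (can g c z)" "v0 = h z x0" using img[OF z(1)] True z(2) by blast
        then have "x0 \<in> {x \<in> elts (can g c z). h z x \<in> Q}" using v0 by blast
        then obtain x where x: "x \<in> elts (can g c z)" "h z x \<in> Q"
            "\<And>y. y \<in> elts x \<Longrightarrow> y \<notin> {x \<in> elts (can g c z). h z x \<in> Q}"
          by (rule foundation_minimal) blast
        have "w \<notin> Q" if w: "w \<in> elts z" "(w, h z x) \<in> R" for w
        proof -
          have "w \<in> h z ` elts (can g c z)" using w img[OF z(1)] unfolding R_def by blast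
          then obtain y where y: "y \<in> elts (can g c z)" "w = h z y" by blast
          then show ?thesis using w(2) iff[OF z(1) y(1) x(1)] x(3) by blast
        qed
        moreover have "h z x \<in> elts z" using x(1) Wz(3)[OF z(1)] by blast
        ultimately show "\<exists>v. v \<in> elts z \<and> ?M z v" using x(2) by blast
      qed
      have "\<exists>\<^sub>F z in dual_filter. ?M z (v z) \<and> v z \<in> elts z"
      proof (rule frequently_elim1)
        show "\<exists>\<^sub>F z in dual_filter. v0 \<in> elts z \<and> W z"
          using True A_l by (intro frequently_eventually_conj[OF W eventually_mem]) blast
      qed (use v in blast)
      then obtain v1 where v1: "\<exists>\<^sub>F z in dual_filter. ?M z (v z) \<and> v z = v1"
        using pressing_down[of "\<lambda>z. ?M z (v z)" v] by blast
      then have "v1 \<in> Q" by (auto dest: frequently_ex)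
      moreover have "w \<notin> Q" if w: "(w, v1) \<in> R" for w
      proof -
        have "w \<in> elts l" using w A_l unfolding R_def by blast
        from frequently_ex[OF frequently_eventually_conj[OF v1 eventually_mem[OF this]]]
        show ?thesis using w by blast
      qed
      ultimately show ?thesis by blast
    qed
  qed
  moreover have "v \<in> A \<and> w \<in> A" if "(v, w) \<in> R" for v w using that unfolding R_def by blast
  ultimately have "\<exists>(b::'v) s. is_ordinal b \<and> bij_betw s A (elts b)
    \<and> (\<forall>v\<in>A. \<forall>w\<in>A. (v, w) \<in> R \<longleftrightarrow> s v \<in> elts (s w))"
    by (rule wellorder_iso_ordinal[OF _ trans _ total A_l])
  then obtain b :: 'v and s where b: "is_ordinal b" and s: "bij_betw s A (elts b)"
    "\<And>v w. v \<in> A \<Longrightarrow> w \<in> A \<Longrightarrow> (v, w) \<in> R \<longleftrightarrow> s v \<in> elts (s w)"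
    by blast
  define u where "u = inv_into A s"
  have u: "bij_betw u (elts b) A" unfolding u_def by (rule bij_betw_inv_into[OF s(1)])
  have u_iff: "(u x, u y) \<in> R \<longleftrightarrow> x \<in> elts y" if "x \<in> elts b" "y \<in> elts b" for x y
  proof -
    have "u x \<in> A" "u y \<in> A" using u that unfolding bij_betw_def by blast+
    moreover have "s (u x) = x" "s (u y) = y"
      using that bij_betw_inv_into_right[OF s(1)] unfolding u_def by blast+
    ultimately show ?thesis using s(2) by metis
  qed
  have u_inj: "inj_on u (elts b)" and u_l: "u ` elts b \<subseteq> elts l"
    using u A_l unfolding bij_betw_def by blast+
  \<comment> \<open>Both \<open>h z\<close> and \<open>u\<close> enumerate the part of
    \<open>A\<close> in \<open>z\<close> in the order \<open>R\<close>; the inverse of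
    \<open>h z\<close> after \<open>u\<close> is therefore the collapse of the hull of
    \<open>b\<close> under \<open>u\<close>.\<close>
  have iso: "can g c z = can u b z \<and> (\<forall>x\<in>elts b. u x \<in> elts z \<longrightarrow> h z (can u x z) = u x)" if z: "W z" for z
  proof -
    let ?D = "{x \<in> elts b. u x \<in> elts z}" and ?i = "inv_into (elts (can g c z)) (h z)"
    have "u ` ?D = A \<inter> elts z" using u unfolding bij_betw_def by blast
    then have uD: "bij_betw u ?D (A \<inter> elts z)"
      using inj_on_subset[OF u_inj, of ?D] unfolding bij_betw_def by blast
    have hz: "bij_betw (h z) (elts (can g c z)) (A \<inter> elts z)"
      using Wz(2)[OF z] img[OF z] unfolding bij_betw_def by blast
    have i: "bij_betw (?i \<circ> u) ?D (elts (can g c z))"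
      by (rule bij_betw_trans[OF uD bij_betw_inv_into[OF hz]])
    have h_i: "h z ((?i \<circ> u) x) = u x" if "x \<in> ?D" for x
      using bij_betw_inv_into_right[OF hz, of "u x"] uD that unfolding bij_betw_def by auto
    have i_mem: "(?i \<circ> u) x \<in> elts (can g c z)" if "x \<in> ?D" for x
      using i that unfolding bij_betw_def by blast
    have i_iff: "x \<in> elts y \<longleftrightarrow> (?i \<circ> u) x \<in> elts ((?i \<circ> u) y)" if "x \<in> ?D" "y \<in> ?D" for x y
      using iff[OF z i_mem i_mem, OF that] h_i u_iff that by simp
    have "can g c z = can u b z"
      by (rule iso_eq_can(1)[OF b ocan i]) (use i_iff in blast)
    moreover have "(?i \<circ> u) x = can u x z" if "x \<in> ?D" for x
      by (rule iso_eq_can(2)[OF b ocan i]) (use i_iff that in blast)+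
    ultimately show ?thesis using h_i by (metis (mono_tags, lifting) mem_Collect_eq)
  qed
  have "\<exists>\<^sub>F z in dual_filter. can g c z = can u b z"
    using W by (rule frequently_elim1) (use iso in blast)
  then have cb: "c = b" using can_frequently_eq[OF c b g u_inj u_l] by blast
  \<comment> \<open>The hulls under \<open>g\<close> and \<open>u\<close> agree almost everywhere,
    so \<open>can g\<close> may replace \<open>can u\<close>.\<close>
  have "\<forall>\<^sub>F z in dual_filter. \<forall>x\<in>elts c. g x \<in> elts z \<longleftrightarrow> u x \<in> elts z"
    by (rule eventually_hull_cong[OF g]) (use u_inj u_l cb in simp_all)
  then have "\<forall>\<^sub>F z in dual_filter. W z \<longrightarrow> (\<forall>x\<in>elts c. g x \<in> elts z \<longrightarrow> h z (can g x z) = u x)"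
  proof eventually_elim
    case (elim z)
    have "can g x z = can u x z" if x: "x \<in> elts c" for x
      using elim ordinal_subset[OF c x] by (intro can_cong ordinal_mem[OF c x]) blast
    then show ?case using iso cb elim by simp
  qed
  then show ?thesis using u_inj u_l cb by blast
qed

section \<open>Approximations read off from the codes\<close>

definition decoder :: "'v \<Rightarrow> 'v \<Rightarrow> 'v \<Rightarrow> 'v" where
  "decoder z b = (SOME h. codes z b h)"

text \<open>The decoder depends only on \<open>z\<close> and \<open>b\<close>, so one family at
  level \<open>b\<close> must serve all larger ordinals; indices below \<open>z\<close> keep it of
  size at most that of \<open>z\<close>.\<close>

definition approximations :: "'v \<Rightarrow> 'v \<Rightarrow> 'v set set" where
  "approximations z b = (\<lambda>i. {x \<in> elts b. decoder z b x \<in> t i}) ` elts z"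

definition trace :: "'v \<Rightarrow> 'v \<Rightarrow> 'v set" where
  "trace a z = (\<lambda>x. can (e a) x z) ` {x \<in> F a. e a x \<in> elts z}"

text \<open>For each \<open>x\<close> in \<open>a\<close>, a larger point of \<open>F a\<close> and
  the position of \<open>x\<close> in \<open>F a\<close> both have codes below \<open>l\<close>,
  hence eventually below \<open>z\<close>; diagonalizing over the hull gives cofinality and the
  bound. Here \<open>g\<close> sends the collapse of \<open>x\<close> to the position of
  \<open>x\<close> in \<open>F a\<close>.\<close>

lemma trace_approximates:
  assumes a: "a \<in> elts m"
  shows "\<forall>\<^sub>F z in dual_filter. trace a z \<subseteq> elts (can (e a) a z)
    \<and> (\<forall>x\<in>elts (can (e a) a z). \<exists>y\<in>trace a z. elts x \<subseteq> elts y)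
    \<and> (\<exists>g. g ` trace a z \<subseteq> elts z \<and> (\<forall>x\<in>trace a z. \<forall>y\<in>trace a z. x \<in> elts y \<longrightarrow> g x \<in> elts (g y)))"
proof -
  have oa: "is_ordinal a" using m_ordinal[OF a] .
  have 1: "\<forall>\<^sub>F z in dual_filter. \<forall>x\<in>elts a. e a x \<in> elts z \<longrightarrow>
      (\<exists>y\<in>F a. e a y \<in> elts z \<and> elts x \<subseteq> elts y) \<and> otp (F a) x \<in> elts z"
  proof (rule eventually_hull[OF e(1)[OF a] e_image[OF a]])
    fix x assume x: "x \<in> elts a"
    obtain y where y: "y \<in> F a" "elts x \<subseteq> elts y" using F(2)[OF a x] by blast
    then have "e a y \<in> elts l" using F(1)[OF a] e(2)[OF a] by blast
    from eventually_mem[OF this] eventually_mem[OF otp_F_mem[OF a x]]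
    show "\<forall>\<^sub>F z in dual_filter. (\<exists>y\<in>F a. e a y \<in> elts z \<and> elts x \<subseteq> elts y) \<and> otp (F a) x \<in> elts z"
      by eventually_elim (use y in blast)
  qed
  show ?thesis
    using 1
  proof eventually_elim
    case (elim z)
    let ?c = "\<lambda>x. can (e a) x z" and ?D = "{x \<in> elts a. e a x \<in> elts z}"
    have F_D: "{x \<in> F a. e a x \<in> elts z} \<subseteq> ?D" using F(1)[OF a] by blast
    have oD: "is_ordinal x" if "x \<in> ?D" for x using that ordinal_mem[OF oa] by blast
    have sub: "trace a z \<subseteq> elts (?c a)" unfolding trace_def elts_can[OF oa] using F_D by blast
    have cof: "\<exists>y\<in>trace a z. elts x \<subseteq> elts y" if x: "x \<in> elts (?c a)" for x
    proof -
      obtain x' where x': "x' \<in> ?D" "x = ?c x'" using x unfolding elts_can[OF oa] by blast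
      then obtain y where y: "y \<in> F a" "e a y \<in> elts z" "elts x' \<subseteq> elts y" using elim by blast
      then have "is_ordinal y" using oD F_D by blast
      then have "elts (?c x') \<subseteq> elts (?c y)"
        using y(3) unfolding elts_can[OF oD[OF x'(1)]] by (auto simp: elts_can)
      then show ?thesis using y x' unfolding trace_def by blast
    qed
    have inj: "inj_on ?c ?D" by (rule inj_onI) (use can_eq_iff oD in blast)
    define g where "g = otp (F a) \<circ> inv_into ?D ?c"
    have g: "g (?c x) = otp (F a) x" if "x \<in> ?D" for x
      unfolding g_def using inv_into_f_f[OF inj that] by simp
    have "g ` trace a z \<subseteq> elts z"
    proof
      fix u assume "u \<in> g ` trace a z"
      then obtain x where x: "x \<in> ?D" "u = g (?c x)" unfolding trace_def using F_D by blast
      then show "u \<in> elts z" using g elim by auto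
    qed
    moreover have "g x \<in> elts (g y)" if xy: "x \<in> trace a z" "y \<in> trace a z" "x \<in> elts y" for x y
    proof -
      obtain x' y' where x': "x' \<in> F a" "x' \<in> ?D" "x = ?c x'" and y': "y' \<in> ?D" "y = ?c y'"
        using xy F_D unfolding trace_def by blast
      then have "x' \<in> elts y'" using xy(3) can_mem_iff[OF oD oD] by blast
      then show ?thesis using g x' y' otp_mono by metis
    qed
    ultimately show ?case using sub cof by blast
  qed
qed

text \<open>On a positive set of failures the chosen codes become traces of a single
  \<open>U\<close>, so \<open>decode\<close> replaces the decoders, which vary with
  \<open>z\<close>, by a fixed injection \<open>u\<close> of \<open>b\<close>.\<close>

lemma trace_initial:
  assumes a: "a \<in> elts m" and b: "b \<in> elts a"
  shows "\<forall>\<^sub>F z in dual_filter. z \<in> p \<longrightarrow> can (e a) b z \<in> elts l \<longrightarrow>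
    trace a z \<inter> elts (can (e a) b z) \<in> approximations z (can (e a) b z)"
proof (rule ccontr)
  let ?c = "can (e a) b"
  let ?h = "\<lambda>z. decoder z (?c z)"
  let ?bad = "\<lambda>z. ?c z \<in> elts l \<and> trace a z \<inter> elts (?c z) \<notin> approximations z (?c z)"
  have oa: "is_ordinal a" using m_ordinal[OF a] .
  have ob: "is_ordinal b" using ordinal_mem[OF oa b] .
  have ba: "elts b \<subseteq> elts a" using ordinal_subset[OF oa b] .
  have eb: "inj_on (e a) (elts b)" "e a ` elts b \<subseteq> elts l"
    using inj_on_subset[OF e(1)[OF a] ba] e_image[OF a] ba by blast+
  have dec: "\<forall>\<^sub>F z in dual_filter. z \<in> p \<longrightarrow> ?c z \<in> elts l \<longrightarrow> codes z (?c z) (?h z)"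
    using eventually_codes
  proof eventually_elim
    case (elim z)
    show ?case unfolding decoder_def using elim someI_ex[of "codes z (?c z)"] by blast
  qed
  assume "\<not> ?thesis"
  then have bad: "\<exists>\<^sub>F z in dual_filter. z \<in> p \<and> ?bad z"
    by (simp add: not_eventually imp_conjL)
  have "\<exists>\<^sub>F z in dual_filter. z \<in> p \<and> (?bad z \<and> codes z (?c z) (?h z)) \<and> set_of (code (?c z) (?h z)) \<in> elts (f z)"
    using frequently_eventually_conj[OF bad dec]
    by (rule frequently_elim1) (auto simp: codes_def)
  then obtain U where U: "U \<subseteq> elts l" "\<exists>\<^sub>F z in dual_filter. z \<in> p \<and> (?bad z \<and> codes z (?c z) (?h z))
      \<and> set_of (code (?c z) (?h z)) = set_of (U \<inter> elts z)"
    using frequently_mem_subset[of "\<lambda>z. ?bad z \<and> codes z (?c z) (?h z)" "\<lambda>z. set_of (code (?c z) (?h z))"]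
    by blast
  let ?W = "\<lambda>z. pr_closed z \<and> z \<in> p \<and> (?bad z \<and> codes z (?c z) (?h z))
      \<and> set_of (code (?c z) (?h z)) = set_of (U \<inter> elts z)"
  have W: "\<exists>\<^sub>F z in dual_filter. ?W z"
    by (rule frequently_eventually_conj[OF U(2) eventually_pr_closed])
  have code_eq: "code (?c z) (?h z) = U \<inter> elts z" if "?W z" for z
  proof -
    have "elts z \<subseteq> elts l" using that ordinal_subset[OF ordinal_l] unfolding pr_closed_def by blast
    then have "?h z ` elts (?c z) \<subseteq> elts l" using that unfolding codes_def by blast
    then have "elts (set_of (code (?c z) (?h z))) = code (?c z) (?h z)"
      by (rule elts_set_of_subset[OF code_subset])
    moreover have "elts (set_of (U \<inter> elts z)) = U \<inter> elts z"
      by (rule elts_set_of_subset) blast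
    ultimately show ?thesis using that by metis
  qed
  have "\<exists>u. inj_on u (elts b) \<and> u ` elts b \<subseteq> elts l \<and>
    (\<forall>\<^sub>F z in dual_filter. ?W z \<longrightarrow> (\<forall>x\<in>elts b. e a x \<in> elts z \<longrightarrow> ?h z (can (e a) x z) = u x))"
    by (rule decode[OF ob eb W _ _ _ code_eq]) (auto simp: codes_def)
  then obtain u where u: "inj_on u (elts b)" "u ` elts b \<subseteq> elts l"
      "\<forall>\<^sub>F z in dual_filter. ?W z \<longrightarrow> (\<forall>x\<in>elts b. e a x \<in> elts z \<longrightarrow> ?h z (can (e a) x z) = u x)"
    by blast
  \<comment> \<open>The index is found from \<open>u\<close> alone, independently of
    \<open>z\<close>; so it is below almost every \<open>z\<close> and names the initial segment
    there.\<close>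
  obtain i where i: "i \<in> elts l" "t i = u ` (F a \<inter> elts b)"
    using F_coded[OF a b u(2)] by blast
  have "\<forall>\<^sub>F z in dual_filter. \<not> ?W z"
    using u(3) eventually_mem[OF i(1)]
  proof eventually_elim
    case (elim z)
    show ?case
    proof
      assume z: "?W z"
      have h: "?h z (can (e a) x z) = u x" if "x \<in> elts b" "e a x \<in> elts z" for x
        using elim(1) z that by blast
      have "y \<in> trace a z \<longleftrightarrow> ?h z y \<in> t i" if y: "y \<in> elts (?c z)" for y
      proof -
        obtain x where x: "x \<in> elts b" "e a x \<in> elts z" "y = can (e a) x z"
          using y unfolding elts_can[OF ob] by blast
        have "y \<in> trace a z \<longleftrightarrow> x \<in> F a"
        proof
          assume "y \<in> trace a z"
          then obtain w where w: "w \<in> F a" "e a w \<in> elts z" "y = can (e a) w z"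
            unfolding trace_def by blast
          have "is_ordinal w" "is_ordinal x"
            using w(1) x(1) F(1)[OF a] ba ordinal_mem[OF oa] by blast+
          then have "w = x" using can_eq_iff[of w x "e a" z] w x by simp
          then show "x \<in> F a" using w(1) by blast
        qed (use x in \<open>auto simp: trace_def\<close>)
        also have "\<dots> \<longleftrightarrow> u x \<in> t i"
          unfolding i(2) using inj_on_image_mem_iff[OF u(1) x(1), of "F a \<inter> elts b"] x(1) by blast
        finally show ?thesis using h[OF x(1,2)] x(3) by simp
      qed
      then have "trace a z \<inter> elts (?c z) = {x \<in> elts (?c z). ?h z x \<in> t i}" by blast
      then show False using z elim(2) unfolding approximations_def by blast
    qed
  qed
  then show False using W unfolding frequently_def by blast
qed

text \<open>The requirement of \<open>weak_square_if_approximations\<close> at \<open>a\<close>,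
  with \<open>z\<close> as the bound on order types and \<open>approximations z\<close> as the
  families.\<close>

definition approximable :: "'v \<Rightarrow> 'v \<Rightarrow> bool" where
  "approximable z a \<longleftrightarrow> (\<exists>E g. E \<subseteq> elts a \<and> (\<forall>x\<in>elts a. \<exists>y\<in>E. elts x \<subseteq> elts y)
    \<and> g ` E \<subseteq> elts z \<and> (\<forall>x\<in>E. \<forall>y\<in>E. x \<in> elts y \<longrightarrow> g x \<in> elts (g y))
    \<and> (\<forall>b\<in>elts a. E \<inter> elts b \<in> approximations z b))"

text \<open>A failing ordinal is, on a positive set, the canonical function of a fixed
  \<open>a\<close>. There \<open>trace a z\<close> is a witness unless one of its initial segments
  is missing; the level of the missing segment can be pressed down to a fixed member of
  \<open>a\<close>, against \<open>trace_initial\<close>.\<close>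

lemma eventually_approximable:
  "\<forall>\<^sub>F z in dual_filter. z \<in> p \<longrightarrow> (\<forall>a\<in>elts l. approximable z a)"
proof (rule ccontr)
  assume "\<not> ?thesis"
  then have fr: "\<exists>\<^sub>F z in dual_filter. z \<in> p \<and> (\<exists>a\<in>elts l. \<not> approximable z a)"
    by (simp add: not_eventually)
  define w where "w z = (SOME a. a \<in> elts l \<and> \<not> approximable z a)" for z
  have w: "w z \<in> elts l \<and> \<not> approximable z (w z)" if "\<exists>a\<in>elts l. \<not> approximable z a" for z
    unfolding w_def by (rule someI_ex) (use that in blast)
  have "\<exists>\<^sub>F z in dual_filter. (z \<in> p \<and> w z \<in> elts l \<and> \<not> approximable z (w z)) \<and> w z \<in> elts l"
    using fr by (rule frequently_elim1) (use w in blast)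
  then obtain a where a: "a \<in> elts m"
      "\<exists>\<^sub>F z in dual_filter. (z \<in> p \<and> w z \<in> elts l \<and> \<not> approximable z (w z)) \<and> w z = can (e a) a z"
    using frequently_ordinal[of "\<lambda>z. z \<in> p \<and> w z \<in> elts l \<and> \<not> approximable z (w z)" w] by blast
  have oa: "is_ordinal a" using m_ordinal[OF a(1)] .
  let ?c = "\<lambda>x z. can (e a) x z"
  let ?bad = "\<lambda>z b. ?c b z \<in> elts l \<and> trace a z \<inter> elts (?c b z) \<notin> approximations z (?c b z)"
  \<comment> \<open>The level is chosen as a member of the hull of \<open>a\<close>, not as its
    collapse, so that Fodor's lemma applies to it.\<close>
  define b where "b z = (SOME b. b \<in> elts a \<and> e a b \<in> elts z \<and> ?bad z b)" for z
  have "\<exists>\<^sub>F z in dual_filter. (z \<in> p \<and> ?bad z (b z)) \<and> b z \<in> elts a \<and> e a (b z) \<in> elts z"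
  proof (rule frequently_elim1[OF frequently_eventually_conj[OF a(2) trace_approximates[OF a(1)]]])
    fix z
    assume z: "(trace a z \<subseteq> elts (?c a z)
      \<and> (\<forall>x\<in>elts (?c a z). \<exists>y\<in>trace a z. elts x \<subseteq> elts y)
      \<and> (\<exists>g. g ` trace a z \<subseteq> elts z \<and> (\<forall>x\<in>trace a z. \<forall>y\<in>trace a z. x \<in> elts y \<longrightarrow> g x \<in> elts (g y))))
      \<and> (z \<in> p \<and> w z \<in> elts l \<and> \<not> approximable z (w z)) \<and> w z = ?c a z"
    then have l: "?c a z \<in> elts l" and not_ok: "\<not> approximable z (?c a z)" by auto
    obtain g where g: "g ` trace a z \<subseteq> elts z"
        "\<forall>x\<in>trace a z. \<forall>y\<in>trace a z. x \<in> elts y \<longrightarrow> g x \<in> elts (g y)"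
      using conjunct2[OF conjunct2[OF conjunct1[OF z]]] by blast
    have "\<exists>y\<in>elts (?c a z). trace a z \<inter> elts y \<notin> approximations z y"
    proof (rule ccontr)
      assume "\<not> ?thesis"
      then have "approximable z (?c a z)"
        unfolding approximable_def using z g
        by (intro exI[of _ "trace a z"] exI[of _ g]) simp
      then show False using not_ok by contradiction
    qed
    then obtain x where x: "x \<in> elts a" "e a x \<in> elts z" "trace a z \<inter> elts (?c x z) \<notin> approximations z (?c x z)"
      unfolding elts_can[OF oa] by blast
    moreover have "?c x z \<in> elts l"
      using ordinal_trans[OF ordinal_l l] can_mono[of a x "e a" z] oa x(1,2) by blast
    ultimately have "\<exists>b. b \<in> elts a \<and> e a b \<in> elts z \<and> ?bad z b" by blast
    then have "b z \<in> elts a \<and> e a (b z) \<in> elts z \<and> ?bad z (b z)" unfolding b_def by (rule someI_ex)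
    then show "(z \<in> p \<and> ?bad z (b z)) \<and> b z \<in> elts a \<and> e a (b z) \<in> elts z" using z by blast
  qed
  then obtain x where x: "x \<in> elts a" "\<exists>\<^sub>F z in dual_filter. (z \<in> p \<and> ?bad z (b z)) \<and> b z = x"
    using pressing_down_hull[OF e(1)[OF a(1)] e_image[OF a(1)], of "\<lambda>z. z \<in> p \<and> ?bad z (b z)" b] by blast
  from frequently_ex[OF frequently_eventually_conj[OF x(2) trace_initial[OF a(1) x(1)]]]
  show False by blast
qed

lemma weak_square: "weak_square k"
proof -
  have "\<exists>\<^sub>F z in dual_filter. z \<in> p" using p unfolding conds_iff by blast
  from frequently_ex[OF frequently_eventually_conj[OF frequently_eventually_conj[OF this
    eventually_approximable] eventually_in]]
  obtain z where z: "z \<in> elts l"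
    and ok: "\<forall>a\<in>elts l. approximable z a"
    by blast
  show ?thesis
  \<comment> \<open>A single good \<open>z\<close> suffices: as an ordinal below \<open>l\<close> it
    has size at most \<open>k\<close>, and it serves as the bound \<open>d\<close>.\<close>
  proof (rule weak_square_if_approximations[OF k l(3)[unfolded l(1)] z[unfolded l(1)], of "approximations z", folded l(1)])
    fix b
    have "elts z \<lesssim> elts k" using z l(3) by blast
    then show "approximations z b \<lesssim> elts k"
      unfolding approximations_def by (rule lepoll_trans[OF image_lepoll])
  qed (rule ok[unfolded approximable_def, rule_format])
qed

end

section \<open>Power sets\<close>

lemma elts_powerset:
  assumes "has_powerset x"
  shows "elts (powerset x) = {z. elts z \<subseteq> elts x}"
proof -
  obtain y where y: "elts y = {z. elts z \<subseteq> elts x}" using assms unfolding has_powerset_def by blast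
  then have "powerset x = y" unfolding powerset_def by (intro the_equality) (auto simp flip: elts_inject)
  then show ?thesis using y by simp
qed

lemma Pow_eqpoll_powerset:
  assumes "has_powerset x"
  shows "Pow (elts x) \<approx> elts (powerset x)"
proof -
  have "bij_betw set_of (Pow (elts x)) (elts (powerset x))"
    by (rule bij_betw_byWitness[of _ elts])
       (auto simp: elts_powerset[OF assms] elts_set_of_subset)
  then show ?thesis unfolding eqpoll_def by blast
qed

text \<open>Images under the bijection turn subsets of \<open>x\<close> into subsets of
  \<open>y\<close>, and replacement collects them. Applied to the power set of \<kappa> and its
  successor cardinal, this gives the power set from which the second successor is obtained.\<close>

lemma has_powerset_eqpoll:
  fixes x y :: "'v::set_universe"
  assumes x: "has_powerset x" and xy: "elts x \<approx> elts y"
  shows "has_powerset y"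
proof -
  obtain g where g: "bij_betw g (elts x) (elts y)" using xy unfolding eqpoll_def by blast
  obtain q where q: "elts q = (\<lambda>z. set_of (g ` elts z)) ` elts (powerset x)"
    using replacement[of "\<lambda>z. set_of (g ` elts z)" "powerset x"] by (rule exE)
  have img: "elts (set_of (g ` elts z)) = g ` elts z" for z
    by (rule elts_set_of) (rule subset_refl)
  have ex: "\<exists>z. elts z \<subseteq> elts x \<and> set_of (g ` elts z) = w" if w: "elts w \<subseteq> elts y" for w
  proof -
    let ?A = "{v \<in> elts x. g v \<in> elts w}"
    have "elts (set_of ?A) = ?A" by (rule elts_set_of_subset) blast
    moreover have "g ` ?A = elts w"
    proof
      show "elts w \<subseteq> g ` ?A"
      proof
        fix v assume v: "v \<in> elts w"
        then obtain u where "u \<in> elts x" "v = g u" using w bij_betw_imp_surj_on[OF g] by blast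
        then show "v \<in> g ` ?A" using v by blast
      qed
    qed blast
    ultimately show ?thesis by (intro exI[of _ "set_of ?A"]) simp
  qed
  have "g ` elts x = elts y" using g unfolding bij_betw_def by blast
  then have "elts (set_of (g ` elts z)) \<subseteq> elts y" if "elts z \<subseteq> elts x" for z
    using that unfolding img by blast
  then have "elts q = {z. elts z \<subseteq> elts y}"
    unfolding q elts_powerset[OF x] using ex by blast
  then show ?thesis unfolding has_powerset_def by blast
qed

theorem proposition2p1:
  fixes \<kappa> :: "'v::set_universe"
  assumes "has_powerset \<kappa>" and "has_powerset (powerset \<kappa>)"
    and "is_cardinal \<kappa>" and "infinite (elts \<kappa>)"
    and "elts (powerset \<kappa>) \<approx> elts (card_succ \<kappa>)"
    and "chang (card_succ (card_succ \<kappa>)) (card_succ \<kappa>) (card_succ \<kappa>) \<kappa> \<or>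
         (\<exists>I. weakly_presaturated (card_succ \<kappa>) I \<and>
              forced (elts (card_succ \<kappa>)) I
                (in_ultrapower (elts (card_succ \<kappa>)) I (powerset (card_succ \<kappa>))))"
  shows "weak_square \<kappa>"
proof -
  define l where "l = card_succ \<kappa>"
  define m where "m = card_succ l"
  have l: "is_cardinal l" "elts l = {a. is_ordinal a \<and> elts a \<lesssim> elts \<kappa>}"
    unfolding l_def using card_succ[OF assms(3) elts_powerset[OF assms(1)]] .
  have pow_l: "has_powerset l"
    unfolding l_def by (rule has_powerset_eqpoll[OF assms(2,5)])
  have m: "is_cardinal m" "elts m = {a. is_ordinal a \<and> elts a \<lesssim> elts l}"
    unfolding m_def using card_succ[OF l(1) elts_powerset[OF pow_l]] .
  have "Pow (elts \<kappa>) \<approx> elts l"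
    unfolding l_def using Pow_eqpoll_powerset[OF assms(1)] assms(5) by (rule eqpoll_trans)
  then have "Pow (elts \<kappa>) \<lesssim> elts l" by (rule eqpoll_imp_lepoll)
  then obtain t e F where "square_coding \<kappa> l m t e F"
    using square_coding_exists[OF assms(3,4) l_def l m_def m] by blast
  then interpret square_coding \<kappa> l m t e F .
  from assms(6)[folded l_def, folded m_def] show ?thesis
  proof (elim disjE exE conjE)
    assume "chang m l l \<kappa>"
    then show ?thesis by (rule weak_square_if_chang)
  next
    fix I
    assume I: "weakly_presaturated l I"
      and pow: "forced (elts l) I (in_ultrapower (elts l) I (powerset l))"
    interpret normal_ideal l I
      by unfold_locales (use I ordinal_l in \<open>auto simp: weakly_presaturated_def\<close>)
    have top: "elts l \<in> conds"
      using ideal unfolding ideal_on_def conditions_def by blast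
    \<comment> \<open>A function for the power set is decided only below some condition, so the
      argument continues below \<open>p\<close>.\<close>
    obtain p f where "p \<in> conds" "coll f (powerset l) p"
      using pow top below_refl unfolding forced_def in_ultrapower_def f_ex_def by blast
    moreover have "coll (ult_embed l) m (elts l)"
      using I top unfolding weakly_presaturated_def forced_def f_and_def m_def by blast
    ultimately interpret generic_powerset \<kappa> l m t e F I p f "powerset l"
      by unfold_locales (simp_all add: elts_powerset[OF pow_l])
    show ?thesis by (rule weak_square)
  qed
qed

end
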